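(* Let $G$ be a connected, regular, simple undirected graph with vertex set $[n]$, $n\geq 6$, let $\sigma_W>0$, and let $\lambda\in[0,1]$. Let $\mathbf{W}\sim\mathcal{N}(\mathbf{0},\sigma_W^2\mathbf{I}_n)$ and let $\mathbf{R}=\mathrm{REM}_G(\lambda,\mathbf{W})$ be the transition rate matrix with $R_{ij}=\exp(\lambda W_i-(1-\lambda)W_j)$ for $(i,j)\in E(G)$ and $R_{ij}=0$ for distinct non-adjacent $i,j$. Then the correlation $\rho=\rho(\mathbf{R})$ satisfies \[ \mathbb{E}(\rho)\geq 1-16\left(1+O(n^{-1/2})\right)(1-\lambda)^2, \] where $O(n^{-1/2})$ denotes a quantity bounded in absolute value by $Cn^{-1/2}$ for an absolute constant $C$ (not depending on $G$, $\sigma_W$ or $\lambda$).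
   Context: For a continuous-time Markov chain with rate matrix $\mathbf{R}$ on $[n]$, the exit rates are $q_i=\sum_{j:\,j\sim i}R_{ij}$ (with $j\sim i$ meaning $(i,j)\in E(G)$), and $\boldsymbol{\pi}$ is its stationary distribution. The correlation is $\rho(\mathbf{R})=\mathrm{Corr}(-\log\pi_I,\log q_I)$ where $I$ is uniform on $[n]$ and the correlation is over $I$ only with $\mathbf{R}$ fixed; $\mathbb{E}$ is over $\mathbf{W}$. *)

theory Defs
  imports "HOL-Probability.Probability"
begin

text \<open>Simple undirected graph on vertex set [n] = {0..<n}, given by adjacency relation E.\<close>
definition simple_graph_on :: "nat \<Rightarrow> (nat \<Rightarrow> nat \<Rightarrow> bool) \<Rightarrow> bool" where
  "simple_graph_on n E \<longleftrightarrow>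
     (\<forall>i j. E i j \<longrightarrow> i < n \<and> j < n) \<and> (\<forall>i j. E i j \<longrightarrow> E j i) \<and> (\<forall>i. \<not> E i i)"

definition graph_connected :: "nat \<Rightarrow> (nat \<Rightarrow> nat \<Rightarrow> bool) \<Rightarrow> bool" where
  "graph_connected n E \<longleftrightarrow> (\<forall>i<n. \<forall>j<n. (i, j) \<in> {(a, b). E a b}\<^sup>*)"

definition graph_regular :: "nat \<Rightarrow> (nat \<Rightarrow> nat \<Rightarrow> bool) \<Rightarrow> bool" where
  "graph_regular n E \<longleftrightarrow> (\<exists>d. \<forall>i<n. card {j. j < n \<and> E i j} = d)"

text \<open>REM rate matrix: R_ij = exp(lam W_i - (1-lam) W_j) on edges, 0 otherwise (off-diagonal).\<close>
definition REM :: "nat \<Rightarrow> (nat \<Rightarrow> nat \<Rightarrow> bool) \<Rightarrow> real \<Rightarrow> (nat \<Rightarrow> real) \<Rightarrow> nat \<Rightarrow> nat \<Rightarrow> real" where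
  "REM n E lam W i j = (if i < n \<and> j < n \<and> E i j then exp (lam * W i - (1 - lam) * W j) else 0)"

text \<open>Exit rates q_i = sum over neighbours j of R_ij.\<close>
definition exit_rate :: "nat \<Rightarrow> (nat \<Rightarrow> nat \<Rightarrow> bool) \<Rightarrow> (nat \<Rightarrow> nat \<Rightarrow> real) \<Rightarrow> nat \<Rightarrow> real" where
  "exit_rate n E R i = (\<Sum>j\<in>{j. j < n \<and> E i j}. R i j)"

text \<open>Stationary distribution of the CTMC with off-diagonal rates R and exit rates q:
  a probability vector on [n] with pi Q = 0, i.e. sum_i pi_i R_ij = pi_j q_j.\<close>
definition is_stationary :: "nat \<Rightarrow> (nat \<Rightarrow> nat \<Rightarrow> bool) \<Rightarrow> (nat \<Rightarrow> nat \<Rightarrow> real) \<Rightarrow> (nat \<Rightarrow> real) \<Rightarrow> bool" where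
  "is_stationary n E R p \<longleftrightarrow>
     (\<forall>i<n. p i \<ge> 0) \<and> (\<forall>i\<ge>n. p i = 0) \<and> (\<Sum>i<n. p i) = 1 \<and>
     (\<forall>j<n. (\<Sum>i\<in>{i. i < n \<and> E i j}. p i * R i j) = p j * exit_rate n E R j)"

definition stationary_dist :: "nat \<Rightarrow> (nat \<Rightarrow> nat \<Rightarrow> bool) \<Rightarrow> (nat \<Rightarrow> nat \<Rightarrow> real) \<Rightarrow> nat \<Rightarrow> real" where
  "stationary_dist n E R = (THE p. is_stationary n E R p)"

text \<open>Pearson correlation of x_I and y_I with I uniform on [n].\<close>
definition unif_mean :: "nat \<Rightarrow> (nat \<Rightarrow> real) \<Rightarrow> real" where
  "unif_mean n x = (\<Sum>i<n. x i) / real n"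

definition unif_cov :: "nat \<Rightarrow> (nat \<Rightarrow> real) \<Rightarrow> (nat \<Rightarrow> real) \<Rightarrow> real" where
  "unif_cov n x y = (\<Sum>i<n. (x i - unif_mean n x) * (y i - unif_mean n y)) / real n"

definition unif_corr :: "nat \<Rightarrow> (nat \<Rightarrow> real) \<Rightarrow> (nat \<Rightarrow> real) \<Rightarrow> real" where
  "unif_corr n x y = unif_cov n x y / sqrt (unif_cov n x x * unif_cov n y y)"

text \<open>rho(R) = Corr(-log pi_I, log q_I).\<close>
definition rho :: "nat \<Rightarrow> (nat \<Rightarrow> nat \<Rightarrow> bool) \<Rightarrow> (nat \<Rightarrow> nat \<Rightarrow> real) \<Rightarrow> real" where
  "rho n E R = unif_corr n (\<lambda>i. - ln (stationary_dist n E R i)) (\<lambda>i. ln (exit_rate n E R i))"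

text \<open>Law of W ~ N(0, sigma^2 I_n) on vectors indexed by [n].\<close>
definition gauss_vec :: "nat \<Rightarrow> real \<Rightarrow> (nat \<Rightarrow> real) measure" where
  "gauss_vec n \<sigma> = (\<Pi>\<^sub>M i\<in>{..<n}. density lborel (normal_density 0 \<sigma>))"

end

theory Submission
  imports Defs "HOL-Real_Asymp.Real_Asymp"
begin

text \<open>
  Write \<open>\<epsilon> = 1 - \<lambda>\<close>. By detailed balance \<open>\<pi>\<^sub>i\<close> is proportional to \<open>exp (- W\<^sub>i)\<close>, so \<open>\<rho>\<close> is the
  correlation of \<open>W\<close> with \<open>\<lambda> W + L\<close>, where \<open>L\<^sub>i\<close> is the logarithm of the sum of \<open>exp (- \<epsilon> W\<^sub>j)\<close> over
  the neighbours \<open>j\<close> of \<open>i\<close>. Plane geometry gives \<open>1 - \<rho> \<le> 2 Var L / (\<lambda>\<^sup>2 Var W)\<close>, the variances being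
  over the vertex. The gradient of the log-sum-exp function has norm at most \<open>\<epsilon>\<close>, so the Gaussian
  Poincare inequality bounds the variance of each \<open>L\<^sub>i\<close> by \<open>\<epsilon>\<^sup>2 \<sigma>\<^sup>2\<close>; by regularity all \<open>L\<^sub>i\<close> have the
  same mean, so this also bounds the expectation of \<open>Var L\<close>. The denominator \<open>Var W\<close> is at least
  \<open>\<sigma>\<^sup>2 / 3\<close> outside an event of exponentially small probability, and on that event the deterministic
  bound \<open>Var L \<le> \<epsilon>\<^sup>2 n Var W\<close> still provides the factor \<open>\<epsilon>\<^sup>2\<close>. Finally \<open>2 / \<lambda>\<^sup>2 \<le> 16 / 3\<close> when
  \<open>\<epsilon>\<^sup>2 < 1 / 8\<close>, while for \<open>\<epsilon>\<^sup>2 \<ge> 1 / 8\<close> the claim follows from \<open>\<rho> \<ge> - 1\<close>.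
\<close>

section \<open>The Gaussian Poincare inequality\<close>

abbreviation centered_normal :: "real \<Rightarrow> real measure" where
  "centered_normal \<sigma> \<equiv> density lborel (normal_density 0 \<sigma>)"

text \<open>Cauchy-Schwarz for \<open>g'\<close> against the constant 1, obtained by integrating the
  nonnegative function \<open>(g' t - m)\<^sup>2\<close>, where \<open>m\<close> is the mean
  slope.\<close>

lemma increment_sq_le_integral_deriv_sq:
  fixes g g' :: "real \<Rightarrow> real"
  assumes "a \<le> b"
    and deriv: "\<And>t. (g has_real_derivative g' t) (at t)"
    and cont: "continuous_on UNIV g'"
  shows "(g b - g a)\<^sup>2 \<le> (b - a) * integral {a..b} (\<lambda>t. (g' t)\<^sup>2)"
proof (cases "a = b")
  case False
  with \<open>a \<le> b\<close> have "a < b" by simp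
  define m where "m = (g b - g a) / (b - a)"
  have c: "continuous_on {a..b} g'"
    using cont continuous_on_subset by blast
  have 1: "(g' has_integral (g b - g a)) {a..b}"
    using deriv \<open>a \<le> b\<close> 
    by (intro fundamental_theorem_of_calculus)
      (auto simp: has_real_derivative_iff_has_vector_derivative[symmetric] intro: has_field_derivative_at_within)
  have 2: "((\<lambda>t. (g' t)\<^sup>2) has_integral (integral {a..b} (\<lambda>t. (g' t)\<^sup>2))) {a..b}"
    by (intro integrable_integral integrable_continuous_interval continuous_intros c)
  have "((\<lambda>t. (g' t)\<^sup>2 - 2 * m * g' t + m\<^sup>2) has_integral
      (integral {a..b} (\<lambda>t. (g' t)\<^sup>2) - 2 * m * (g b - g a) + (b - a) * m\<^sup>2)) {a..b}"
    using has_integral_const_real[of "m\<^sup>2" a b] \<open>a < b\<close>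
    by (intro has_integral_add has_integral_diff 2 has_integral_mult_right 1) (simp add: mult.commute)
  then have "0 \<le> integral {a..b} (\<lambda>t. (g' t)\<^sup>2) - 2 * m * (g b - g a) + (b - a) * m\<^sup>2"
    by (rule has_integral_nonneg) (use zero_le_power2[of "g' _ - m"] in \<open>simp add: power2_diff algebra_simps\<close>)
  also have "\<dots> = integral {a..b} (\<lambda>t. (g' t)\<^sup>2) - (g b - g a)\<^sup>2 / (b - a)"
  proof -
    have "g b - g a = m * (b - a)" using \<open>a < b\<close> by (simp add: m_def)
    then show ?thesis using \<open>a < b\<close> by (simp add: power2_eq_square)
  qed
  finally show ?thesis using \<open>a < b\<close> by (simp add: field_simps)
qed auto

text \<open>The form needed for Fubini: the range of \<open>t\<close> is expressed by an indicator.
  The half-open interval turns membership of \<open>t\<close> into \<open>a \<le> t\<close> and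
  \<open>t < b\<close>, and the corresponding half-lines \<open>{..t}\<close> and
  \<open>{t<..}\<close> partition the real line.\<close>

lemma increment_sq_le_nn_integral:
  fixes g g' :: "real \<Rightarrow> real"
  assumes deriv: "\<And>t. (g has_real_derivative g' t) (at t)"
    and cont: "continuous_on UNIV g'"
    and "a \<le> b"
  shows "ennreal ((g b - g a)\<^sup>2) \<le>
    (\<integral>\<^sup>+t. ennreal ((b - a) * (g' t)\<^sup>2) * indicator {a..<b} t \<partial>lborel)"
proof -
  have c: "continuous_on {a..b} g'"
    using cont continuous_on_subset by blast
  have "((\<lambda>t. (b - a) * (g' t)\<^sup>2) has_integral ((b - a) * integral {a..b} (\<lambda>t. (g' t)\<^sup>2))) {a..b}"
    by (intro has_integral_mult_right integrable_integral integrable_continuous_interval continuous_intros c)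
  from nn_integral_has_integral_lebesgue'[OF _ this]
  have "(\<integral>\<^sup>+t. ennreal ((b - a) * (g' t)\<^sup>2) * indicator {a..b} t \<partial>lborel)
      = ennreal ((b - a) * integral {a..b} (\<lambda>t. (g' t)\<^sup>2))"
    using \<open>a \<le> b\<close> by simp
  moreover have "(\<integral>\<^sup>+t. ennreal ((b - a) * (g' t)\<^sup>2) * indicator {a..b} t \<partial>lborel)
      = (\<integral>\<^sup>+t. ennreal ((b - a) * (g' t)\<^sup>2) * indicator {a..<b} t \<partial>lborel)"
    using AE_lborel_singleton[of b]
    by (intro nn_integral_cong_AE) (auto elim!: eventually_mono simp: indicator_def)
  ultimately show ?thesis
    using increment_sq_le_integral_deriv_sq[OF \<open>a \<le> b\<close> deriv cont]
    by (simp add: ennreal_leI)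
qed

section \<open>The inequality on the real line\<close>

context
  fixes \<sigma> :: real
  assumes \<sigma>: "\<sigma> > 0"
begin

interpretation N: prob_space "centered_normal \<sigma>"
  using \<sigma> by (rule prob_space_normal_density)

lemma integrable_id_centered_normal: "integrable (centered_normal \<sigma>) (\<lambda>x. x)"
  using integrable_normal_moment_nz_1[OF \<sigma>, of 0]
  by (subst integrable_density) (auto simp: mult.commute)

lemma integral_id_centered_normal: "(\<integral>x. x \<partial>centered_normal \<sigma>) = 0"
  using integral_normal_moment_nz_1[OF \<sigma>, of 0]
  by (subst integral_density) (auto simp: mult.commute)

lemma has_real_derivative_normal_density:
  "((\<lambda>x. - \<sigma>\<^sup>2 * normal_density 0 \<sigma> x) has_real_derivative normal_density 0 \<sigma> x * x) (at x)"
  unfolding normal_density_def using \<sigma>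
  by (auto intro!: derivative_eq_intros simp: field_simps power2_eq_square)

text \<open>Fundamental theorem of calculus with the antiderivative
  \<open>- \<sigma>\<^sup>2 * normal_density 0 \<sigma> x\<close>, which vanishes at
  infinity.\<close>

lemma integral_greaterThan_centered_normal:
  "(\<integral>x. x * indicator {t<..} x \<partial>centered_normal \<sigma>) = \<sigma>\<^sup>2 * normal_density 0 \<sigma> t"
proof -
  have "(\<integral>x. x * indicator {t<..} x \<partial>centered_normal \<sigma>)
      = (\<integral>x. indicator {t<..} x *\<^sub>R (normal_density 0 \<sigma> x * x) \<partial>lborel)"
    by (subst integral_density) (auto simp: ac_simps intro!: Bochner_Integration.integral_cong)
  also have "\<dots> = (LBINT x=ereal t..\<infinity>. normal_density 0 \<sigma> x * x)"
    by (simp add: interval_lebesgue_integral_def set_lebesgue_integral_def einterval_def greaterThan_def)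
  also have "\<dots> = 0 - (- \<sigma>\<^sup>2 * normal_density 0 \<sigma> t)"
  proof (rule interval_integral_FTC_integrable)
    show "((\<lambda>x. - \<sigma>\<^sup>2 * normal_density 0 \<sigma> x) has_vector_derivative normal_density 0 \<sigma> x * x) (at x)" for x
      using has_real_derivative_normal_density by (simp add: has_real_derivative_iff_has_vector_derivative)
    show "isCont (\<lambda>x. normal_density 0 \<sigma> x * x) x" for x
      unfolding normal_density_def using \<sigma> by (intro continuous_intros) auto
    show "set_integrable lborel (einterval (ereal t) \<infinity>) (\<lambda>x. normal_density 0 \<sigma> x * x)"
      using integrable_normal_moment_nz_1[OF \<sigma>, of 0]
      unfolding set_integrable_def by (intro integrable_mult_indicator) auto
    have "isCont (\<lambda>x. - \<sigma>\<^sup>2 * normal_density 0 \<sigma> x) t"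
      unfolding normal_density_def using \<sigma> by (intro continuous_intros) auto
    then have "((\<lambda>x. - \<sigma>\<^sup>2 * normal_density 0 \<sigma> x) \<longlongrightarrow> - \<sigma>\<^sup>2 * normal_density 0 \<sigma> t) (at_right t)"
      unfolding isCont_def by (rule filterlim_mono) (auto simp: at_within_le_at)
    then show "(((\<lambda>x. - \<sigma>\<^sup>2 * normal_density 0 \<sigma> x) \<circ> real_of_ereal) \<longlongrightarrow> - \<sigma>\<^sup>2 * normal_density 0 \<sigma> t) (at_right (ereal t))"
      by (simp add: ereal_tendsto_simps)
    have "((\<lambda>x. - \<sigma>\<^sup>2 * normal_density 0 \<sigma> x) \<longlongrightarrow> 0) at_top"
      unfolding normal_density_def using \<sigma> by real_asymp
    then show "(((\<lambda>x. - \<sigma>\<^sup>2 * normal_density 0 \<sigma> x) \<circ> real_of_ereal) \<longlongrightarrow> 0) (at_left \<infinity>)"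
      by (simp add: ereal_tendsto_simps)
  qed auto
  finally show ?thesis by simp
qed

text \<open>This identity is what makes the one-dimensional Poincare constant exactly \<open>\<sigma>\<^sup>2\<close>.\<close>

lemma crossing_length_centered_normal:
  "(\<integral>\<^sup>+x. \<integral>\<^sup>+y. ennreal (y - x) * indicator {x..<y} t \<partial>centered_normal \<sigma> \<partial>centered_normal \<sigma>)
    = ennreal (\<sigma>\<^sup>2 * normal_density 0 \<sigma> t)"
proof -
  let ?N = "centered_normal \<sigma>"
  let ?a = "\<sigma>\<^sup>2 * normal_density 0 \<sigma> t"
  define P where "P = measure ?N {t<..}"
  have intI: "integrable ?N (\<lambda>x. x * indicator A x)" if "A \<in> sets borel" for A
    by (rule integrable_real_mult_indicator) (simp_all add: that integrable_id_centered_normal)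
  have ii: "integrable ?N (indicator A :: real \<Rightarrow> real)" if "A \<in> sets borel" for A
    using that by (intro integrable_real_indicator) (simp_all add: N.emeasure_eq_measure)
  \<comment> \<open>The mean is zero, so the two truncated first moments are opposite.\<close>
  have A: "(\<integral>x. x * indicator {..t} x \<partial>?N) = - ?a"
  proof -
    have "(\<integral>x. x * indicator {..t} x \<partial>?N) + (\<integral>x. x * indicator {t<..} x \<partial>?N) = (\<integral>x. x \<partial>?N)"
      by (subst Bochner_Integration.integral_add[symmetric]; (rule intI)?)
        (auto intro!: Bochner_Integration.integral_cong simp: indicator_def)
    then show ?thesis
      by (simp add: integral_greaterThan_centered_normal integral_id_centered_normal)
  qed
  have Q: "measure ?N {..t} = 1 - P"
    unfolding P_def using N.prob_compl[of "{t<..}"] 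
    by (simp add: Compl_eq_Diff_UNIV[symmetric] Compl_greaterThan)
  \<comment> \<open>Membership of \<open>t\<close> splits into \<open>x \<le> t\<close> and
    \<open>t < y\<close>; integrating over the second condition leaves the upper truncated moment
    minus \<open>x\<close> times the tail mass \<open>P\<close>.\<close>
  have inner: "(\<integral>\<^sup>+y. ennreal (y - x) * indicator {x..<y} t \<partial>?N)
      = ennreal ((?a - x * P) * indicator {..t} x)" for x
  proof (cases "x \<le> t")
    case True
    have "(\<integral>\<^sup>+y. ennreal (y - x) * indicator {x..<y} t \<partial>?N)
        = (\<integral>\<^sup>+y. ennreal (y * indicator {t<..} y - x * indicator {t<..} y) \<partial>?N)"
      using True by (intro nn_integral_cong) (auto simp: indicator_def)
    also have "\<dots> = ennreal (\<integral>y. y * indicator {t<..} y - x * indicator {t<..} y \<partial>?N)"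
      using True
      by (intro nn_integral_eq_integral Bochner_Integration.integrable_diff intI integrable_mult_right ii)
        (auto simp: indicator_def)
    also have "(\<integral>y. y * indicator {t<..} y - x * indicator {t<..} y \<partial>?N) = ?a - x * P"
      by (subst Bochner_Integration.integral_diff)
        (auto intro!: intI ii simp: integral_greaterThan_centered_normal P_def)
    finally show ?thesis using True by simp
  qed simp
  have nonneg: "0 \<le> (?a - x * P) * indicator {..t} x" for x
  proof (cases "x \<le> t")
    case True
    have "x * P = (\<integral>y. x * indicator {t<..} y \<partial>?N)" by (simp add: P_def)
    also have "\<dots> \<le> (\<integral>y. y * indicator {t<..} y \<partial>?N)"
      using True by (intro integral_mono intI integrable_mult_right ii) (auto simp: indicator_def)
    finally show ?thesis by (simp add: integral_greaterThan_centered_normal)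
  qed simp
  have "(\<integral>\<^sup>+x. \<integral>\<^sup>+y. ennreal (y - x) * indicator {x..<y} t \<partial>?N \<partial>?N)
      = (\<integral>\<^sup>+x. ennreal (?a * indicator {..t} x - P * (x * indicator {..t} x)) \<partial>?N)"
    unfolding inner by (simp add: algebra_simps)
  also have "\<dots> = ennreal (\<integral>x. ?a * indicator {..t} x - P * (x * indicator {..t} x) \<partial>?N)"
    using nonneg
    by (intro nn_integral_eq_integral Bochner_Integration.integrable_diff intI integrable_mult_right ii)
      (auto simp: algebra_simps)
  \<comment> \<open>The tail mass cancels: the lower half-line has mass \<open>1 - P\<close> and
    truncated first moment \<open>- ?a\<close>.\<close>
  also have "(\<integral>x. ?a * indicator {..t} x - P * (x * indicator {..t} x) \<partial>?N) = ?a * (1 - P) - P * (- ?a)"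
    by (subst Bochner_Integration.integral_diff)
      (auto intro!: intI ii simp: A Q)
  also have "\<dots> = ?a" by (simp add: algebra_simps)
  finally show ?thesis .
qed

text \<open>After Fubini has put \<open>t\<close> outermost, \<open>(g' t)\<^sup>2\<close> carries
  as weight the expected length of the random interval from \<open>x\<close> to \<open>y\<close> on
  the event that it contains \<open>t\<close>, which is \<open>\<sigma>\<^sup>2\<close> times the
  normal density. For square-integrable \<open>g\<close> the left side is twice the variance, which
  matches the factor 2.\<close>

lemma gaussian_poincare_real:
  fixes g g' :: "real \<Rightarrow> real"
  assumes deriv: "\<And>t. (g has_real_derivative g' t) (at t)"
    and cont: "continuous_on UNIV g'"
  shows "(\<integral>\<^sup>+x. \<integral>\<^sup>+y. ennreal ((g x - g y)\<^sup>2) \<partial>centered_normal \<sigma> \<partial>centered_normal \<sigma>)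
    \<le> 2 * ennreal (\<sigma>\<^sup>2) * (\<integral>\<^sup>+t. ennreal ((g' t)\<^sup>2) \<partial>centered_normal \<sigma>)"
proof -
  let ?N = "centered_normal \<sigma>"
  \<comment> \<open>\<open>F x y t\<close> vanishes unless \<open>x \<le> t < y\<close>, so
    \<open>F x y t + F y x t\<close> covers both orders of the endpoints.\<close>
  define F where "F x y t = ennreal ((g' t)\<^sup>2) * (ennreal (y - x) * indicator {x..<y} t)" for x y t
  have [measurable]: "g' \<in> borel_measurable borel"
    using cont by (rule borel_measurable_continuous_onI)
  have F[measurable (raw)]: "(\<lambda>p. F (a p) (b p) (c p)) \<in> borel_measurable M"
    if [measurable]: "a \<in> borel_measurable M" "b \<in> borel_measurable M" "c \<in> borel_measurable M"
    for M :: "'b measure" and a b c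
    unfolding F_def indicator_def atLeastLessThan_iff by measurable
  interpret L: pair_sigma_finite ?N lborel by unfold_locales
  interpret NN: pair_sigma_finite ?N ?N by unfold_locales
  have le: "ennreal ((g x - g y)\<^sup>2) \<le> (\<integral>\<^sup>+t. F x y t + F y x t \<partial>lborel)" for x y
    using increment_sq_le_nn_integral[OF deriv cont, of x y] increment_sq_le_nn_integral[OF deriv cont, of y x]
    by (cases "x \<le> y") (auto simp: F_def ennreal_mult' ac_simps power2_commute)
  have "(\<integral>\<^sup>+x. \<integral>\<^sup>+y. ennreal ((g x - g y)\<^sup>2) \<partial>?N \<partial>?N)
     \<le> (\<integral>\<^sup>+x. \<integral>\<^sup>+y. \<integral>\<^sup>+t. F x y t + F y x t \<partial>lborel \<partial>?N \<partial>?N)"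
    by (intro nn_integral_mono le)
  also have "\<dots> = (\<integral>\<^sup>+t. \<integral>\<^sup>+x. \<integral>\<^sup>+y. F x y t + F y x t \<partial>?N \<partial>?N \<partial>lborel)"
    by (subst L.Fubini'[symmetric], measurable, intro nn_integral_cong L.Fubini'[symmetric], measurable)
  also have "\<dots> = (\<integral>\<^sup>+t. (\<integral>\<^sup>+x. \<integral>\<^sup>+y. F x y t \<partial>?N \<partial>?N) + (\<integral>\<^sup>+x. \<integral>\<^sup>+y. F y x t \<partial>?N \<partial>?N) \<partial>lborel)"
    by (simp add: nn_integral_add)
  also have "\<dots> = (\<integral>\<^sup>+t. 2 * (\<integral>\<^sup>+x. \<integral>\<^sup>+y. F x y t \<partial>?N \<partial>?N) \<partial>lborel)"
    by (subst (2) NN.Fubini') (simp_all add: mult_2)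
  also have "\<dots> = (\<integral>\<^sup>+t. 2 * ennreal ((g' t)\<^sup>2) * ennreal (\<sigma>\<^sup>2 * normal_density 0 \<sigma> t) \<partial>lborel)"
    unfolding F_def indicator_def atLeastLessThan_iff
    by (simp add: nn_integral_cmult mult.assoc
        crossing_length_centered_normal[unfolded indicator_def atLeastLessThan_iff]) 
  also have "\<dots> = (\<integral>\<^sup>+t. 2 * ennreal (\<sigma>\<^sup>2) * (ennreal (normal_density 0 \<sigma> t) * ennreal ((g' t)\<^sup>2)) \<partial>lborel)"
    by (simp add: ennreal_mult ac_simps)
  also have "\<dots> = 2 * ennreal (\<sigma>\<^sup>2) * (\<integral>\<^sup>+t. ennreal ((g' t)\<^sup>2) \<partial>?N)"
    by (simp add: nn_integral_cmult nn_integral_density)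
  finally show ?thesis .
qed

end

text \<open>Tensorization of the variance (Efron-Stein for two coordinates). A quadrilateral
  inequality is averaged over independent points \<open>(x, y)\<close> and \<open>(x', y')\<close>;
  exchanging \<open>y\<close> with \<open>y'\<close> preserves the joint law, so both diagonals
  average to \<open>?T\<close>.\<close>

lemma nn_integral_diff_sq_pair_le:
  fixes F :: "'a \<Rightarrow> 'b \<Rightarrow> real"
  assumes "prob_space M1" "prob_space M2"
    and F: "case_prod F \<in> borel_measurable (M1 \<Otimes>\<^sub>M M2)"
  shows "(\<integral>\<^sup>+x. \<integral>\<^sup>+y. \<integral>\<^sup>+x'. \<integral>\<^sup>+y'. ennreal ((F x y - F x' y')\<^sup>2) \<partial>M2 \<partial>M1 \<partial>M2 \<partial>M1)
    \<le> (\<integral>\<^sup>+x. \<integral>\<^sup>+y. \<integral>\<^sup>+y'. ennreal ((F x y - F x y')\<^sup>2) \<partial>M2 \<partial>M2 \<partial>M1)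
      + (\<integral>\<^sup>+y. \<integral>\<^sup>+x. \<integral>\<^sup>+x'. ennreal ((F x y - F x' y)\<^sup>2) \<partial>M1 \<partial>M1 \<partial>M2)"
    (is "?T \<le> ?S1 + ?S2")
proof -
  interpret M1: prob_space M1 by fact
  interpret M2: prob_space M2 by fact
  interpret P12: pair_sigma_finite M1 M2 by unfold_locales
  interpret P22: pair_sigma_finite M2 M2 by unfold_locales
  define Q where "Q x y x' y' = ennreal ((F x y - F x' y')\<^sup>2)" for x y x' y'
  have Fm[measurable (raw)]: "(\<lambda>p. F (a p) (b p)) \<in> borel_measurable M"
    if [measurable]: "a \<in> measurable M M1" "b \<in> measurable M M2" for M :: "'c measure" and a b
    using measurable_compose[OF measurable_Pair[OF that] F] by simp
  have Q[measurable (raw)]: "(\<lambda>p. Q (a p) (b p) (c p) (d p)) \<in> borel_measurable M"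
    if [measurable]: "a \<in> measurable M M1" "b \<in> measurable M M2" "c \<in> measurable M M1" "d \<in> measurable M M2"
    for M :: "'c measure" and a b c d
    unfolding Q_def by measurable
  have swapped: "?T = (\<integral>\<^sup>+x. \<integral>\<^sup>+y. \<integral>\<^sup>+x'. \<integral>\<^sup>+y'. Q x y' x' y \<partial>M2 \<partial>M1 \<partial>M2 \<partial>M1)"
    unfolding Q_def[symmetric]
  proof (rule nn_integral_cong)
    fix x assume [measurable]: "x \<in> space M1"
    have "(\<integral>\<^sup>+y. \<integral>\<^sup>+x'. \<integral>\<^sup>+y'. Q x y x' y' \<partial>M2 \<partial>M1 \<partial>M2)
        = (\<integral>\<^sup>+y. \<integral>\<^sup>+y'. \<integral>\<^sup>+x'. Q x y x' y' \<partial>M1 \<partial>M2 \<partial>M2)"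
      by (intro nn_integral_cong P12.Fubini'[symmetric]) measurable
    also have "\<dots> = (\<integral>\<^sup>+y'. \<integral>\<^sup>+y. \<integral>\<^sup>+x'. Q x y x' y' \<partial>M1 \<partial>M2 \<partial>M2)"
      by (rule P22.Fubini') measurable
    also have "\<dots> = (\<integral>\<^sup>+y'. \<integral>\<^sup>+x'. \<integral>\<^sup>+y. Q x y x' y' \<partial>M2 \<partial>M1 \<partial>M2)"
      by (intro nn_integral_cong P12.Fubini') measurable
    finally show "(\<integral>\<^sup>+y. \<integral>\<^sup>+x'. \<integral>\<^sup>+y'. Q x y x' y' \<partial>M2 \<partial>M1 \<partial>M2)
        = (\<integral>\<^sup>+y. \<integral>\<^sup>+x'. \<integral>\<^sup>+y'. Q x y' x' y \<partial>M2 \<partial>M1 \<partial>M2)" .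
  qed
  \<comment> \<open>Each side of the quadrilateral changes one coordinate only; the variable that no
    longer occurs integrates to one.\<close>
  have s1: "(\<integral>\<^sup>+x. \<integral>\<^sup>+y. \<integral>\<^sup>+x'. \<integral>\<^sup>+y'. Q x y x y' \<partial>M2 \<partial>M1 \<partial>M2 \<partial>M1) = ?S1"
    by (simp add: Q_def M1.emeasure_space_1)
  have s2: "(\<integral>\<^sup>+x. \<integral>\<^sup>+y. \<integral>\<^sup>+x'. \<integral>\<^sup>+y'. Q x' y x' y' \<partial>M2 \<partial>M1 \<partial>M2 \<partial>M1) = ?S1"
    by (subst P12.Fubini') (simp_all add: Q_def[symmetric] M1.emeasure_space_1)
  have s3: "(\<integral>\<^sup>+x. \<integral>\<^sup>+y. \<integral>\<^sup>+x'. \<integral>\<^sup>+y'. Q x y x' y \<partial>M2 \<partial>M1 \<partial>M2 \<partial>M1) = ?S2"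
    by (subst P12.Fubini'[symmetric]) (simp_all add: Q_def[symmetric] M2.emeasure_space_1)
  have s4: "(\<integral>\<^sup>+x. \<integral>\<^sup>+y. \<integral>\<^sup>+x'. \<integral>\<^sup>+y'. Q x y' x' y' \<partial>M2 \<partial>M1 \<partial>M2 \<partial>M1) = ?S2"
  proof -
    have "(\<integral>\<^sup>+x. \<integral>\<^sup>+y. \<integral>\<^sup>+x'. \<integral>\<^sup>+y'. Q x y' x' y' \<partial>M2 \<partial>M1 \<partial>M2 \<partial>M1)
       = (\<integral>\<^sup>+x. \<integral>\<^sup>+x'. \<integral>\<^sup>+y'. Q x y' x' y' \<partial>M2 \<partial>M1 \<partial>M1)"
      by (simp add: M2.emeasure_space_1)
    also have "\<dots> = (\<integral>\<^sup>+x. \<integral>\<^sup>+y'. \<integral>\<^sup>+x'. Q x y' x' y' \<partial>M1 \<partial>M2 \<partial>M1)"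
      by (intro nn_integral_cong P12.Fubini'[symmetric]) measurable
    also have "\<dots> = ?S2"
      unfolding Q_def[symmetric] by (rule P12.Fubini'[symmetric]) measurable
    finally show ?thesis .
  qed
  \<comment> \<open>The two diagonals of a quadrilateral are controlled by its four sides; working with the
    doubled variance keeps all integrands nonnegative, so no integrability is needed.\<close>
  have quad: "Q x y x' y' + Q x y' x' y \<le> Q x y x y' + Q x' y x' y' + Q x y x' y + Q x y' x' y'" for x y x' y'
  proof -
    have "(a - d)\<^sup>2 + (b - c)\<^sup>2 \<le> (a - b)\<^sup>2 + (c - d)\<^sup>2 + (a - c)\<^sup>2 + (b - d)\<^sup>2" for a b c d :: real
      using zero_le_power2[of "a - b - c + d"] by (simp add: power2_eq_square algebra_simps)
    then show ?thesis
      unfolding Q_def by (simp flip: ennreal_plus)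
  qed
  have "2 * ?T = ?T + (\<integral>\<^sup>+x. \<integral>\<^sup>+y. \<integral>\<^sup>+x'. \<integral>\<^sup>+y'. Q x y' x' y \<partial>M2 \<partial>M1 \<partial>M2 \<partial>M1)"
    by (simp add: mult_2 flip: swapped)
  also have "\<dots> = (\<integral>\<^sup>+x. \<integral>\<^sup>+y. \<integral>\<^sup>+x'. \<integral>\<^sup>+y'. Q x y x' y' + Q x y' x' y \<partial>M2 \<partial>M1 \<partial>M2 \<partial>M1)"
    unfolding Q_def[symmetric] by (simp add: nn_integral_add cong: nn_integral_cong)
  also have "\<dots> \<le> (\<integral>\<^sup>+x. \<integral>\<^sup>+y. \<integral>\<^sup>+x'. \<integral>\<^sup>+y'.
      Q x y x y' + Q x' y x' y' + Q x y x' y + Q x y' x' y' \<partial>M2 \<partial>M1 \<partial>M2 \<partial>M1)"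
    by (intro nn_integral_mono quad)
  also have "\<dots> = ?S1 + ?S1 + ?S2 + ?S2"
    by (simp add: nn_integral_add s1 s2 s3 s4 del: nn_integral_const cong: nn_integral_cong)
  also have "\<dots> = 2 * (?S1 + ?S2)"
    by (simp add: mult_2 algebra_simps)
  finally show ?thesis
    by (subst (asm) ennreal_mult_le_mult_iff) auto
qed

text \<open>Induction over the coordinates: tensorization separates the new coordinate
  \<open>k\<close>, treated by the one-dimensional inequality, from the old ones, treated by the
  induction hypothesis with the value at \<open>k\<close> frozen.\<close>

lemma gaussian_poincare:
  fixes f :: "('i \<Rightarrow> real) \<Rightarrow> real" and D :: "'i \<Rightarrow> ('i \<Rightarrow> real) \<Rightarrow> real"
  assumes \<sigma>: "\<sigma> > 0" and "finite I"
    and f: "f \<in> borel_measurable (\<Pi>\<^sub>M i\<in>I. centered_normal \<sigma>)"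
    and D: "\<And>j. j \<in> I \<Longrightarrow> D j \<in> borel_measurable (\<Pi>\<^sub>M i\<in>I. centered_normal \<sigma>)"
    and deriv: "\<And>j x t. j \<in> I \<Longrightarrow> ((\<lambda>s. f (x(j := s))) has_real_derivative D j (x(j := t))) (at t)"
    and cont: "\<And>j x. j \<in> I \<Longrightarrow> continuous_on UNIV (\<lambda>t. D j (x(j := t)))"
  shows "(\<integral>\<^sup>+x. \<integral>\<^sup>+y. ennreal ((f x - f y)\<^sup>2) \<partial>(\<Pi>\<^sub>M i\<in>I. centered_normal \<sigma>) \<partial>(\<Pi>\<^sub>M i\<in>I. centered_normal \<sigma>))
    \<le> 2 * ennreal (\<sigma>\<^sup>2) * (\<Sum>j\<in>I. \<integral>\<^sup>+x. ennreal ((D j x)\<^sup>2) \<partial>(\<Pi>\<^sub>M i\<in>I. centered_normal \<sigma>))"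
  using \<open>finite I\<close> f D deriv cont
proof (induction I arbitrary: f D rule: finite_induct)
  case empty
  show ?case by (simp add: PiM_empty nn_integral_count_space_finite)
next
  case (insert k I)
  let ?N = "centered_normal \<sigma>"
  let ?P = "\<Pi>\<^sub>M i\<in>I. ?N" and ?P' = "\<Pi>\<^sub>M i\<in>insert k I. ?N"
  have N: "prob_space ?N" by (intro prob_space_normal_density \<sigma>)
  interpret product_sigma_finite "\<lambda>_::'i. ?N"
    by (rule product_sigma_finite.intro) (intro prob_space_imp_sigma_finite N)
  interpret N: prob_space ?N by fact
  interpret P: prob_space ?P by (intro prob_space_PiM N)
  note fI = \<open>finite I\<close> \<open>k \<notin> I\<close>
  have [measurable]: "f \<in> borel_measurable ?P'" by fact
  have D[measurable]: "D j \<in> borel_measurable ?P'" if "j \<in> insert k I" for j using insert.prems that by blast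
  have upd[measurable]: "(\<lambda>(x, y). x(k := y)) \<in> measurable (?P \<Otimes>\<^sub>M ?N) ?P'"
    by (rule measurable_add_dim)
  have upd'[measurable (raw)]: "(\<lambda>p. (a p)(k := b p)) \<in> measurable M ?P'"
    if "a \<in> measurable M ?P" "b \<in> measurable M ?N" for M :: "'c measure" and a b
    using measurable_compose[OF measurable_Pair[OF that] upd] by simp
  define F where "F x y = f (x(k := y))" for x y
  have Fm: "case_prod F \<in> borel_measurable (?P \<Otimes>\<^sub>M ?N)"
    unfolding F_def by measurable
  interpret P': prob_space ?P' by (intro prob_space_PiM N)
  have "(\<integral>\<^sup>+x. \<integral>\<^sup>+y. ennreal ((f x - f y)\<^sup>2) \<partial>?P' \<partial>?P')
      = (\<integral>\<^sup>+x. \<integral>\<^sup>+y. \<integral>\<^sup>+x'. \<integral>\<^sup>+y'. ennreal ((F x y - F x' y')\<^sup>2) \<partial>?N \<partial>?P \<partial>?N \<partial>?P)"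
    unfolding F_def by (subst product_nn_integral_insert[OF fI], measurable,
      intro nn_integral_cong product_nn_integral_insert[OF fI], measurable)
  also have "\<dots> \<le> (\<integral>\<^sup>+x. \<integral>\<^sup>+y. \<integral>\<^sup>+y'. ennreal ((F x y - F x y')\<^sup>2) \<partial>?N \<partial>?N \<partial>?P)
      + (\<integral>\<^sup>+y. \<integral>\<^sup>+x. \<integral>\<^sup>+x'. ennreal ((F x y - F x' y)\<^sup>2) \<partial>?P \<partial>?P \<partial>?N)"
    by (rule nn_integral_diff_sq_pair_le[OF _ N Fm]) unfold_locales
  also have "\<dots> \<le> (\<integral>\<^sup>+x. 2 * ennreal (\<sigma>\<^sup>2) * (\<integral>\<^sup>+y. ennreal ((D k (x(k := y)))\<^sup>2) \<partial>?N) \<partial>?P)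
      + (\<integral>\<^sup>+y. 2 * ennreal (\<sigma>\<^sup>2) * (\<Sum>j\<in>I. \<integral>\<^sup>+x. ennreal ((D j (x(k := y)))\<^sup>2) \<partial>?P) \<partial>?N)"
  proof (intro add_mono nn_integral_mono)
    show "(\<integral>\<^sup>+y. \<integral>\<^sup>+y'. ennreal ((F x y - F x y')\<^sup>2) \<partial>?N \<partial>?N)
        \<le> 2 * ennreal (\<sigma>\<^sup>2) * (\<integral>\<^sup>+y. ennreal ((D k (x(k := y)))\<^sup>2) \<partial>?N)" for x
      unfolding F_def by (intro gaussian_poincare_real \<sigma> insert.prems(3,4)) auto
    show "(\<integral>\<^sup>+x. \<integral>\<^sup>+x'. ennreal ((F x y - F x' y)\<^sup>2) \<partial>?P \<partial>?P)
        \<le> 2 * ennreal (\<sigma>\<^sup>2) * (\<Sum>j\<in>I. \<integral>\<^sup>+x. ennreal ((D j (x(k := y)))\<^sup>2) \<partial>?P)" for y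
      unfolding F_def
    proof (rule insert.IH)
      show "(\<lambda>x. f (x(k := y))) \<in> borel_measurable ?P" by simp
      fix j assume j: "j \<in> I"
      then have [measurable]: "D j \<in> borel_measurable ?P'" by (intro D) auto
      show "(\<lambda>x. D j (x(k := y))) \<in> borel_measurable ?P" by simp
      have jk: "j \<noteq> k" using j fI by auto
      show "((\<lambda>s. f (x(j := s, k := y))) has_real_derivative D j (x(j := t, k := y))) (at t)" for x t
        unfolding fun_upd_twist[OF jk] by (intro insert.prems) (use j in auto)
      show "continuous_on UNIV (\<lambda>t. D j (x(j := t, k := y)))" for x
        unfolding fun_upd_twist[OF jk] by (intro insert.prems) (use j in auto)
    qed
  qed
  also have "\<dots> = 2 * ennreal (\<sigma>\<^sup>2) * (\<integral>\<^sup>+x. ennreal ((D k x)\<^sup>2) \<partial>?P')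
      + 2 * ennreal (\<sigma>\<^sup>2) * (\<Sum>j\<in>I. \<integral>\<^sup>+x. ennreal ((D j x)\<^sup>2) \<partial>?P')"
  proof -
    have "(\<integral>\<^sup>+x. 2 * ennreal (\<sigma>\<^sup>2) * (\<integral>\<^sup>+y. ennreal ((D k (x(k := y)))\<^sup>2) \<partial>?N) \<partial>?P)
        = 2 * ennreal (\<sigma>\<^sup>2) * (\<integral>\<^sup>+x. ennreal ((D k x)\<^sup>2) \<partial>?P')"
      using D[of k] by (simp add: nn_integral_cmult product_nn_integral_insert[OF fI])
    moreover have "(\<integral>\<^sup>+y. 2 * ennreal (\<sigma>\<^sup>2) * (\<Sum>j\<in>I. \<integral>\<^sup>+x. ennreal ((D j (x(k := y)))\<^sup>2) \<partial>?P) \<partial>?N)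
        = 2 * ennreal (\<sigma>\<^sup>2) * (\<Sum>j\<in>I. \<integral>\<^sup>+x. ennreal ((D j x)\<^sup>2) \<partial>?P')"
      using D by (simp add: nn_integral_cmult nn_integral_sum product_nn_integral_insert_rev[OF fI])
    ultimately show ?thesis by simp
  qed
  also have "\<dots> = 2 * ennreal (\<sigma>\<^sup>2) * (\<Sum>j\<in>insert k I. \<integral>\<^sup>+x. ennreal ((D j x)\<^sup>2) \<partial>?P')"
    using fI by (simp add: distrib_left)
  finally show ?case .
qed

section \<open>Concentration of log-sum-exp\<close>

text \<open>With \<open>\<epsilon> = 1 - lam\<close> and \<open>A\<close> the neighbours of
  \<open>i\<close>, this is the logarithm of the exit rate at \<open>i\<close> minus
  \<open>lam * x i\<close>.\<close>

definition log_sum_exp :: "real \<Rightarrow> 'i set \<Rightarrow> ('i \<Rightarrow> real) \<Rightarrow> real" where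
  "log_sum_exp \<epsilon> A x = ln (\<Sum>j\<in>A. exp (- \<epsilon> * x j))"

lemma borel_measurable_log_sum_exp:
  assumes "A \<subseteq> I"
  shows "log_sum_exp \<epsilon> A \<in> borel_measurable (\<Pi>\<^sub>M i\<in>I. centered_normal \<sigma>)"
proof -
  have [measurable]: "(\<lambda>x. x j) \<in> borel_measurable (\<Pi>\<^sub>M i\<in>I. centered_normal \<sigma>)" if "j \<in> A" for j
    using measurable_component_singleton[of j I "\<lambda>_. centered_normal \<sigma>"] that assms by auto
  show ?thesis unfolding log_sum_exp_def[abs_def] by measurable
qed

text \<open>The gradient is \<open>- \<epsilon>\<close> times a vector of softmax weights. These are
  nonnegative with sum 1, so their squares sum to at most 1, and the bound does not depend on the
  size of \<open>I\<close>.\<close>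

lemma nn_integral_log_sum_exp_diff_sq_le:
  fixes I :: "'i set"
  assumes \<sigma>: "\<sigma> > 0" and I: "finite I" "I \<noteq> {}"
  defines "P \<equiv> \<Pi>\<^sub>M i\<in>I. centered_normal \<sigma>"
  shows "(\<integral>\<^sup>+x. \<integral>\<^sup>+y. ennreal ((log_sum_exp \<epsilon> I x - log_sum_exp \<epsilon> I y)\<^sup>2) \<partial>P \<partial>P)
    \<le> ennreal (2 * (\<epsilon>\<^sup>2 * \<sigma>\<^sup>2))"
proof -
  define S where "S x = (\<Sum>j\<in>I. exp (- \<epsilon> * x j))" for x :: "'i \<Rightarrow> real"
  define D where "D j x = - \<epsilon> * (exp (- \<epsilon> * x j) / S x)" for j x
  have S: "S x > 0" for x
    unfolding S_def using I by (intro sum_pos) auto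
  have [measurable]: "(\<lambda>x. x j) \<in> borel_measurable P" if "j \<in> I" for j
    using measurable_component_singleton[of j I "\<lambda>_. centered_normal \<sigma>"] that by (auto simp: P_def)
  have [measurable]: "S \<in> borel_measurable P" unfolding S_def[abs_def] by measurable
  have D[measurable]: "D j \<in> borel_measurable P" if "j \<in> I" for j
    unfolding D_def[abs_def] using that by measurable
  have lse: "log_sum_exp \<epsilon> I = (\<lambda>x. ln (S x))"
    by (simp add: log_sum_exp_def S_def fun_eq_iff)
  \<comment> \<open>Along a line in direction \<open>j\<close> only one summand varies, which
    reduces the partial derivative to one-variable calculus.\<close>
  have upd: "S (x(j := s)) = exp (- \<epsilon> * s) + (\<Sum>i\<in>I - {j}. exp (- \<epsilon> * x i))" if "j \<in> I" for j x s
    unfolding S_def using I that by (subst sum.remove[of _ j]) (auto intro!: sum.cong)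
  have deriv: "((\<lambda>s. log_sum_exp \<epsilon> I (x(j := s))) has_real_derivative D j (x(j := t))) (at t)" if "j \<in> I" for j x t
  proof -
    have "0 < exp (- \<epsilon> * t) + (\<Sum>i\<in>I - {j}. exp (- \<epsilon> * x i))"
      by (intro add_pos_nonneg sum_nonneg) auto
    then have "((\<lambda>s. ln (exp (- \<epsilon> * s) + (\<Sum>i\<in>I - {j}. exp (- \<epsilon> * x i)))) has_real_derivative
       - \<epsilon> * (exp (- \<epsilon> * t) / (exp (- \<epsilon> * t) + (\<Sum>i\<in>I - {j}. exp (- \<epsilon> * x i))))) (at t)"
      by (auto intro!: derivative_eq_intros simp: field_simps)
    then show ?thesis
      unfolding lse D_def using that by (simp add: upd)
  qed
  have cont: "continuous_on UNIV (\<lambda>t. D j (x(j := t)))" if "j \<in> I" for j x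
  proof -
    have pos: "0 < exp (- \<epsilon> * t) + (\<Sum>i\<in>I - {j}. exp (- \<epsilon> * x i))" for t
      by (intro add_pos_nonneg sum_nonneg) auto
    show ?thesis
      unfolding D_def using that pos
      by (simp add: upd) (intro continuous_intros; metis less_irrefl pos)
  qed
  have bound: "(\<Sum>j\<in>I. (D j x)\<^sup>2) \<le> \<epsilon>\<^sup>2" for x
  proof -
    have "(exp (- \<epsilon> * x j) / S x)\<^sup>2 \<le> exp (- \<epsilon> * x j) / S x" if "j \<in> I" for j
    proof -
      have "exp (- \<epsilon> * x j) \<le> S x"
        unfolding S_def using I that by (intro member_le_sum) auto
      then have "exp (- \<epsilon> * x j) / S x \<le> 1" using S[of x] by simp
      moreover have "0 \<le> exp (- \<epsilon> * x j) / S x" using S[of x] by simp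
      ultimately show ?thesis
        using mult_left_le power2_eq_square by metis
    qed
    then have "(\<Sum>j\<in>I. (exp (- \<epsilon> * x j) / S x)\<^sup>2) \<le> (\<Sum>j\<in>I. exp (- \<epsilon> * x j) / S x)"
      by (rule sum_mono)
    also have "\<dots> = 1"
      using S[of x] by (simp add: S_def flip: sum_divide_distrib)
    finally have "\<epsilon>\<^sup>2 * (\<Sum>j\<in>I. (exp (- \<epsilon> * x j) / S x)\<^sup>2) \<le> \<epsilon>\<^sup>2 * 1"
      by (intro mult_left_mono) auto
    moreover have "(D j x)\<^sup>2 = \<epsilon>\<^sup>2 * (exp (- \<epsilon> * x j) / S x)\<^sup>2" for j
      by (simp add: D_def power_mult_distrib power_divide)
    ultimately show ?thesis by (simp add: sum_distrib_left)
  qed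
  interpret P: prob_space P
    unfolding P_def by (intro prob_space_PiM prob_space_normal_density \<sigma>)
  have "(\<integral>\<^sup>+x. \<integral>\<^sup>+y. ennreal ((log_sum_exp \<epsilon> I x - log_sum_exp \<epsilon> I y)\<^sup>2) \<partial>P \<partial>P)
      \<le> 2 * ennreal (\<sigma>\<^sup>2) * (\<Sum>j\<in>I. \<integral>\<^sup>+x. ennreal ((D j x)\<^sup>2) \<partial>P)"
    unfolding P_def
    by (intro gaussian_poincare \<sigma> I borel_measurable_log_sum_exp order_refl deriv cont D[unfolded P_def])
  also have "(\<Sum>j\<in>I. \<integral>\<^sup>+x. ennreal ((D j x)\<^sup>2) \<partial>P) = (\<integral>\<^sup>+x. ennreal (\<Sum>j\<in>I. (D j x)\<^sup>2) \<partial>P)"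
    by (subst nn_integral_sum[symmetric]) (auto intro!: nn_integral_cong)
  also have "\<dots> \<le> (\<integral>\<^sup>+x. ennreal (\<epsilon>\<^sup>2) \<partial>P)"
    by (intro nn_integral_mono ennreal_leI bound)
  also have "2 * ennreal (\<sigma>\<^sup>2) * (\<integral>\<^sup>+x. ennreal (\<epsilon>\<^sup>2) \<partial>P) = ennreal (2 * (\<epsilon>\<^sup>2 * \<sigma>\<^sup>2))"
    by (simp add: P.emeasure_space_1 ennreal_mult ac_simps)
  finally show ?thesis by (simp add: mult_left_mono)
qed

text \<open>Expanding the square for two independent copies gives twice the variance. The square
  integrability that this expansion requires is extracted from the finiteness of the double
  integral.\<close>

lemma (in prob_space) nn_integral_centered_sq_le:
  fixes f :: "'a \<Rightarrow> real"
  assumes [measurable]: "f \<in> borel_measurable M" and "0 \<le> c"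
    and le: "(\<integral>\<^sup>+x. \<integral>\<^sup>+y. ennreal ((f x - f y)\<^sup>2) \<partial>M \<partial>M) \<le> ennreal (2 * c)"
  shows "(\<integral>\<^sup>+x. ennreal ((f x - expectation f)\<^sup>2) \<partial>M) \<le> ennreal c"
proof -
  \<comment> \<open>Since the double integral is finite, some inner integral is finite, which makes
    \<open>f - f x0\<close> square-integrable.\<close>
  obtain x0 where x0: "(\<integral>\<^sup>+y. ennreal ((f x0 - f y)\<^sup>2) \<partial>M) < \<infinity>"
  proof (rule ccontr)
    assume "\<not> thesis"
    with that have "(\<integral>\<^sup>+y. ennreal ((f x - f y)\<^sup>2) \<partial>M) = \<infinity>" for x
      by (metis infinity_ennreal_def less_top)
    with le show False by (simp add: emeasure_space_1 top_unique)
  qed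
  define h where "h x = f x - f x0" for x
  have [measurable]: "h \<in> borel_measurable M" unfolding h_def by measurable
  have h2: "integrable M (\<lambda>x. (h x)\<^sup>2)"
    using x0 by (intro integrableI_bounded) (auto simp: h_def power2_commute)
  then have h1: "integrable M h" by (rule square_integrable_imp_integrable[rotated]) simp
  have "expectation f = expectation (\<lambda>x. h x + f x0)" by (simp add: h_def)
  then have Ef: "expectation f = expectation h + f x0" using h1 by (simp add: prob_space)
  let ?m = "expectation h" and ?s = "expectation (\<lambda>x. (h x)\<^sup>2)"
  have sqd: "0 \<le> (h x)\<^sup>2 - 2 * h x * h y + (h y)\<^sup>2" for x y
    using zero_le_power2[of "h x - h y"] by (simp add: power2_diff)
  have inner: "(\<integral>\<^sup>+y. ennreal ((f x - f y)\<^sup>2) \<partial>M) = ennreal ((h x)\<^sup>2 - 2 * h x * ?m + ?s)" for x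
  proof -
    have "(\<integral>\<^sup>+y. ennreal ((f x - f y)\<^sup>2) \<partial>M) = (\<integral>\<^sup>+y. ennreal ((h x)\<^sup>2 - 2 * h x * h y + (h y)\<^sup>2) \<partial>M)"
      by (simp add: h_def power2_eq_square algebra_simps)
    also have "\<dots> = ennreal (\<integral>y. (h x)\<^sup>2 - 2 * h x * h y + (h y)\<^sup>2 \<partial>M)"
      using h1 h2 by (intro nn_integral_eq_integral) (auto simp: sqd)
    also have "(\<integral>y. (h x)\<^sup>2 - 2 * h x * h y + (h y)\<^sup>2 \<partial>M) = (h x)\<^sup>2 - 2 * h x * ?m + ?s"
      using h1 h2 by (simp add: prob_space)
    finally show ?thesis .
  qed
  have nonneg: "0 \<le> (h x)\<^sup>2 - 2 * h x * ?m + ?s" for x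
  proof -
    have "0 \<le> (\<integral>y. (h x)\<^sup>2 - 2 * h x * h y + (h y)\<^sup>2 \<partial>M)"
      by (intro Bochner_Integration.integral_nonneg) (simp add: sqd)
    also have "\<dots> = (h x)\<^sup>2 - 2 * h x * ?m + ?s"
      using h1 h2 by (simp add: prob_space)
    finally show ?thesis .
  qed
  have "(\<integral>\<^sup>+x. \<integral>\<^sup>+y. ennreal ((f x - f y)\<^sup>2) \<partial>M \<partial>M)
      = ennreal (\<integral>x. (h x)\<^sup>2 - 2 * ?m * h x + ?s \<partial>M)"
    unfolding inner using h1 h2 nonneg
    by (subst nn_integral_eq_integral) (auto simp: mult.commute mult.left_commute)
  also have "(\<integral>x. (h x)\<^sup>2 - 2 * ?m * h x + ?s \<partial>M) = 2 * (?s - ?m\<^sup>2)"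
    using h1 h2 by (simp add: prob_space power2_eq_square)
  finally have "?s - ?m\<^sup>2 \<le> c"
    using le \<open>0 \<le> c\<close> by (simp add: ennreal_le_iff)
  moreover have "(\<integral>\<^sup>+x. ennreal ((f x - expectation f)\<^sup>2) \<partial>M) = ennreal (\<integral>x. (h x)\<^sup>2 - 2 * ?m * h x + ?m\<^sup>2 \<partial>M)"
  proof -
    have sq: "(f x - expectation f)\<^sup>2 = (h x)\<^sup>2 - 2 * ?m * h x + ?m\<^sup>2" for x
      unfolding Ef by (simp add: h_def power2_eq_square algebra_simps)
    then have "0 \<le> (h x)\<^sup>2 - 2 * ?m * h x + ?m\<^sup>2" for x
      by (metis zero_le_power2)
    then show ?thesis
      unfolding sq by (intro nn_integral_eq_integral) (use h1 h2 in auto)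
  qed
  moreover have "(\<integral>x. (h x)\<^sup>2 - 2 * ?m * h x + ?m\<^sup>2 \<partial>M) = ?s - ?m\<^sup>2"
    using h1 h2 by (simp add: prob_space power2_eq_square)
  ultimately show ?thesis by (simp add: ennreal_leI)
qed

text \<open>The coordinates are independent and identically distributed, so relabelling
  \<open>A\<close> by \<open>{..<d}\<close> preserves the law and only the cardinality of
  \<open>A\<close> matters. This is how regularity of the graph enters.\<close>

lemma nn_integral_PiM_log_sum_exp_reindex:
  assumes \<sigma>: "\<sigma> > 0" and A: "A \<subseteq> K" "finite A" "card A = d"
    and [measurable]: "\<phi> \<in> borel_measurable borel"
  shows "(\<integral>\<^sup>+x. \<phi> (log_sum_exp \<epsilon> A x) \<partial>(\<Pi>\<^sub>M i\<in>K. centered_normal \<sigma>))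
    = (\<integral>\<^sup>+x. \<phi> (log_sum_exp \<epsilon> {..<d} x) \<partial>(\<Pi>\<^sub>M i\<in>{..<d}. centered_normal \<sigma>))"
proof -
  let ?N = "centered_normal \<sigma>"
  obtain h where h: "bij_betw h {..<d} A"
    using A ex_bij_betw_nat_finite[of A] by (auto simp: lessThan_atLeast0)
  let ?t = "\<lambda>x. \<lambda>i\<in>{..<d}. x (h i)"
  have hK: "h \<in> {..<d} \<rightarrow> K" using h A by (auto simp: bij_betw_def)
  have "(\<Pi>\<^sub>M i\<in>{..<d}. ?N) = distr (\<Pi>\<^sub>M i\<in>K. ?N) (\<Pi>\<^sub>M i\<in>{..<d}. ?N) ?t"
    using distr_PiM_reindex[of K "\<lambda>_. ?N" h "{..<d}"] h hK prob_space_normal_density[OF \<sigma>]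
    by (auto simp: bij_betw_def)
  then have "(\<integral>\<^sup>+x. \<phi> (log_sum_exp \<epsilon> {..<d} x) \<partial>(\<Pi>\<^sub>M i\<in>{..<d}. ?N))
      = (\<integral>\<^sup>+x. \<phi> (log_sum_exp \<epsilon> {..<d} x) \<partial>distr (\<Pi>\<^sub>M i\<in>K. ?N) (\<Pi>\<^sub>M i\<in>{..<d}. ?N) ?t)"
    by simp
  also have "\<dots> = (\<integral>\<^sup>+x. \<phi> (log_sum_exp \<epsilon> {..<d} (?t x)) \<partial>(\<Pi>\<^sub>M i\<in>K. ?N))"
  proof (rule nn_integral_distr)
    show "?t \<in> measurable (\<Pi>\<^sub>M i\<in>K. ?N) (\<Pi>\<^sub>M i\<in>{..<d}. ?N)"
      using hK by (intro measurable_restrict measurable_component_singleton) auto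
    show "(\<lambda>x. \<phi> (log_sum_exp \<epsilon> {..<d} x)) \<in> borel_measurable (distr (\<Pi>\<^sub>M i\<in>K. ?N) (\<Pi>\<^sub>M i\<in>{..<d}. ?N) ?t)"
      unfolding measurable_distr_eq1 using borel_measurable_log_sum_exp[OF order_refl] by measurable
  qed
  also have "\<dots> = (\<integral>\<^sup>+x. \<phi> (log_sum_exp \<epsilon> A x) \<partial>(\<Pi>\<^sub>M i\<in>K. ?N))"
  proof -
    have "(\<Sum>j<d. exp (- \<epsilon> * x (h j))) = (\<Sum>j\<in>A. exp (- \<epsilon> * x j))" for x :: "'a \<Rightarrow> real"
      using h by (rule sum.reindex_bij_betw)
    then show ?thesis by (simp add: log_sum_exp_def)
  qed
  finally show ?thesis ..
qed

text \<open>The centre \<open>m\<close>, the expectation in the model with index set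
  \<open>{..<d}\<close>, is chosen before \<open>A\<close>, so that one number serves all vertices
  of a regular graph.\<close>

lemma log_sum_exp_concentration:
  assumes \<sigma>: "\<sigma> > 0" and d: "d > 0"
  obtains m where "\<And>A K. \<lbrakk>A \<subseteq> K; finite A; card A = d\<rbrakk> \<Longrightarrow>
    (\<integral>\<^sup>+x. ennreal ((log_sum_exp \<epsilon> A x - m)\<^sup>2) \<partial>(\<Pi>\<^sub>M i\<in>K. centered_normal \<sigma>)) \<le> ennreal (\<epsilon>\<^sup>2 * \<sigma>\<^sup>2)"
proof -
  let ?P = "\<Pi>\<^sub>M i\<in>{..<d}. centered_normal \<sigma>"
  interpret P: prob_space ?P by (intro prob_space_PiM prob_space_normal_density \<sigma>)
  define m where "m = P.expectation (log_sum_exp \<epsilon> {..<d})"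
  have *: "(\<integral>\<^sup>+x. ennreal ((log_sum_exp \<epsilon> {..<d} x - m)\<^sup>2) \<partial>?P) \<le> ennreal (\<epsilon>\<^sup>2 * \<sigma>\<^sup>2)"
    unfolding m_def using d
    by (intro P.nn_integral_centered_sq_le nn_integral_log_sum_exp_diff_sq_le borel_measurable_log_sum_exp \<sigma>) auto
  show thesis
  proof (rule that)
    fix A K :: "'a set"
    assume "A \<subseteq> K" "finite A" "card A = d"
    from nn_integral_PiM_log_sum_exp_reindex[OF \<sigma> this, of "\<lambda>u. ennreal ((u - m)\<^sup>2)" \<epsilon>] *
    show "(\<integral>\<^sup>+x. ennreal ((log_sum_exp \<epsilon> A x - m)\<^sup>2) \<partial>(\<Pi>\<^sub>M i\<in>K. centered_normal \<sigma>)) \<le> ennreal (\<epsilon>\<^sup>2 * \<sigma>\<^sup>2)"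
      by simp
  qed
qed

section \<open>Correlations over a uniform index\<close>

lemma unif_cov_cong:
  "(\<And>i. i < n \<Longrightarrow> x i = x' i) \<Longrightarrow> (\<And>i. i < n \<Longrightarrow> y i = y' i) \<Longrightarrow> unif_cov n x y = unif_cov n x' y'"
  unfolding unif_cov_def unif_mean_def
  by (intro arg_cong2[where f = "(/)"] sum.cong arg_cong2[where f = "(*)"] arg_cong2[where f = "(-)"]) auto

lemma unif_mean_add: "unif_mean n (\<lambda>i. x i + y i) = unif_mean n x + unif_mean n y"
  by (simp add: unif_mean_def sum.distrib add_divide_distrib)

lemma unif_mean_cmult: "unif_mean n (\<lambda>i. c * x i) = c * unif_mean n x"
  by (simp add: unif_mean_def flip: sum_distrib_left)

lemma unif_mean_const: "n > 0 \<Longrightarrow> unif_mean n (\<lambda>i. c) = c"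
  by (simp add: unif_mean_def)

lemma unif_cov_commute: "unif_cov n x y = unif_cov n y x"
  by (simp add: unif_cov_def mult.commute)

lemma unif_cov_self_nonneg: "0 \<le> unif_cov n x x"
  by (auto simp: unif_cov_def intro!: divide_nonneg_nonneg sum_nonneg)

lemma unif_cov_affine_right:
  "unif_cov n x (\<lambda>i. c * y i + z i) = c * unif_cov n x y + unif_cov n x z"
  unfolding unif_cov_def unif_mean_add unif_mean_cmult
  by (simp add: algebra_simps sum.distrib sum_subtractf sum_distrib_left add_divide_distrib diff_divide_distrib)

lemma unif_cov_affine_left:
  "unif_cov n (\<lambda>i. c * y i + z i) x = c * unif_cov n y x + unif_cov n z x"
  using unif_cov_affine_right[of n x c y z] by (simp add: unif_cov_commute)

lemma unif_cov_const_right: "unif_cov n x (\<lambda>i. c) = 0"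
  by (cases "n = 0") (simp_all add: unif_cov_def unif_mean_const)

lemma unif_cov_sq_le: "(unif_cov n x y)\<^sup>2 \<le> unif_cov n x x * unif_cov n y y"
  using Cauchy_Schwarz_ineq_sum[of "\<lambda>i. x i - unif_mean n x" "\<lambda>i. y i - unif_mean n y" "{..<n}"]
  by (simp add: unif_cov_def power_divide divide_right_mono flip: power2_eq_square)

lemma abs_unif_corr_le_1: "\<bar>unif_corr n x y\<bar> \<le> 1"
proof -
  have "\<bar>unif_cov n x y\<bar> \<le> sqrt (unif_cov n x x * unif_cov n y y)"
    using real_sqrt_le_mono[OF unif_cov_sq_le[of n x y]] by simp
  then show ?thesis
    unfolding unif_corr_def
    by (cases "sqrt (unif_cov n x x * unif_cov n y y) = 0") (auto simp: abs_divide divide_le_eq_1)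
qed

text \<open>The mean minimizes the sum of squared deviations. This lets a fixed centre replace the
  random mean over the vertices.\<close>

lemma unif_cov_self_le:
  assumes "n > 0"
  shows "unif_cov n x x \<le> (\<Sum>i<n. (x i - m)\<^sup>2) / real n"
proof -
  let ?\<mu> = "unif_mean n x"
  have s: "(\<Sum>i<n. x i) = real n * ?\<mu>" using assms by (simp add: unif_mean_def)
  have "(\<Sum>i<n. (x i - m)\<^sup>2) = (\<Sum>i<n. (x i - ?\<mu>)\<^sup>2 + (2 * (?\<mu> - m) * x i + (m\<^sup>2 - ?\<mu>\<^sup>2)))"
    by (intro sum.cong) (auto simp: power2_eq_square algebra_simps)
  also have "\<dots> = (\<Sum>i<n. (x i - ?\<mu>)\<^sup>2) + real n * (?\<mu> - m)\<^sup>2"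
    by (simp add: sum.distrib s flip: sum_distrib_left) (simp add: power2_eq_square algebra_simps)
  finally have "(\<Sum>i<n. (x i - ?\<mu>)\<^sup>2) \<le> (\<Sum>i<n. (x i - m)\<^sup>2)" by simp
  then show ?thesis
    unfolding unif_cov_def by (simp add: divide_right_mono flip: power2_eq_square)
qed

text \<open>Among centered vectors, \<open>lam * x\<close>, \<open>l\<close> and their sum form a
  triangle, and \<open>r\<close> is the cosine of the angle between \<open>lam * x\<close> and the
  sum. For \<open>r \<ge> 0\<close> the side \<open>l\<close> is no shorter than the distance from
  \<open>lam * x\<close> to the line of the sum, whose square is proportional to
  \<open>1 - r\<^sup>2\<close>; for \<open>r < 0\<close> it is no shorter than
  \<open>lam * x\<close>.\<close>

lemma one_minus_unif_corr_le:
  assumes x: "unif_cov n x x > 0" and lam: "lam > 0"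
  shows "1 - unif_corr n x (\<lambda>i. lam * x i + l i) \<le> 2 * unif_cov n l l / (lam\<^sup>2 * unif_cov n x x)"
proof -
  let ?y = "\<lambda>i. lam * x i + l i"
  define a where "a = unif_cov n x x"
  define b where "b = unif_cov n ?y ?y"
  define s where "s = unif_cov n x ?y"
  define r where "r = unif_corr n x ?y"
  have r: "r = s / sqrt (a * b)" by (simp add: r_def unif_corr_def a_def b_def s_def)
  have r1: "- 1 \<le> r" "r \<le> 1" using abs_unif_corr_le_1[of n x ?y] by (simp_all add: r_def)
  have a: "a > 0" using x by (simp add: a_def)
  have b0: "b \<ge> 0" by (simp add: b_def unif_cov_self_nonneg)
  have ll: "unif_cov n l l = b - 2 * lam * s + lam\<^sup>2 * a"
    unfolding a_def b_def s_def
    unfolding unif_cov_affine_left unif_cov_affine_right unif_cov_commute[of n l x]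
    by (simp add: power2_eq_square algebra_simps)
  \<comment> \<open>If \<open>b = 0\<close>, then \<open>r\<close> is a quotient by zero, but
    Cauchy-Schwarz forces \<open>s = 0\<close> and the identity survives.\<close>
  have srs: "s = r * (sqrt a * sqrt b)"
  proof (cases "b = 0")
    case True
    then have "s\<^sup>2 \<le> 0" using unif_cov_sq_le[of n x ?y] by (simp add: a_def b_def s_def)
    then show ?thesis using True by simp
  next
    case False
    then show ?thesis using a b0 by (simp add: r real_sqrt_mult)
  qed
  define \<alpha> where "\<alpha> = lam * sqrt a"
  define \<beta> where "\<beta> = sqrt b"
  have \<alpha>: "\<alpha> > 0" using a lam by (simp add: \<alpha>_def)
  have \<beta>: "\<beta> \<ge> 0" using b0 by (simp add: \<beta>_def)
  \<comment> \<open>The law of cosines.\<close>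
  have ll': "unif_cov n l l = \<beta>\<^sup>2 - 2 * r * \<alpha> * \<beta> + \<alpha>\<^sup>2"
    unfolding ll srs \<alpha>_def \<beta>_def using a b0 by (simp add: power_mult_distrib)
  have "(1 - r) * \<alpha>\<^sup>2 \<le> 2 * unif_cov n l l"
  proof (cases "r \<ge> 0")
    case True
    have "2 * unif_cov n l l - (1 - r) * \<alpha>\<^sup>2 = 2 * (\<beta> - r * \<alpha>)\<^sup>2 + (1 - r) * (1 + 2 * r) * \<alpha>\<^sup>2"
      unfolding ll' by (simp add: power2_eq_square algebra_simps)
    also have "\<dots> \<ge> 0" using True r1 by simp
    finally show ?thesis by simp
  next
    case False
    have "2 * unif_cov n l l - (1 - r) * \<alpha>\<^sup>2 = 2 * \<beta>\<^sup>2 + 4 * ((- r) * \<alpha> * \<beta>) + (1 + r) * \<alpha>\<^sup>2"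
      unfolding ll' by (simp add: power2_eq_square algebra_simps)
    also have "\<dots> \<ge> 0"
    proof -
      have "0 \<le> (- r) * \<alpha> * \<beta>" using False \<alpha> \<beta> by (intro mult_nonneg_nonneg) auto
      moreover have "0 \<le> (1 + r) * \<alpha>\<^sup>2" using r1 by simp
      ultimately show ?thesis using zero_le_power2[of \<beta>] by linarith
    qed
    finally show ?thesis by simp
  qed
  moreover have "\<alpha>\<^sup>2 = lam\<^sup>2 * a" using a by (simp add: \<alpha>_def power_mult_distrib)
  ultimately have "1 - r \<le> 2 * unif_cov n l l / (lam\<^sup>2 * a)"
    using a lam by (simp add: pos_le_divide_eq)
  then show ?thesis by (simp add: r_def a_def)
qed

text \<open>Each summand is within a factor \<open>exp (\<epsilon> * M)\<close> of
  \<open>exp (- \<epsilon> * c)\<close>, hence so is the average of the summands.\<close>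

lemma log_sum_exp_deviation:
  assumes A: "finite A" "A \<noteq> {}" and "0 \<le> \<epsilon>" and M: "\<And>j. j \<in> A \<Longrightarrow> \<bar>x j - c\<bar> \<le> M"
  shows "\<bar>log_sum_exp \<epsilon> A x - (ln (card A) - \<epsilon> * c)\<bar> \<le> \<epsilon> * M"
proof -
  have card: "real (card A) > 0" using A by (simp add: card_gt_0_iff)
  have S: "(\<Sum>j\<in>A. exp (- \<epsilon> * x j)) > 0" using A by (intro sum_pos) auto
  have b: "- \<epsilon> * c - \<epsilon> * M \<le> - \<epsilon> * x j" "- \<epsilon> * x j \<le> - \<epsilon> * c + \<epsilon> * M" if "j \<in> A" for j
  proof -
    have "\<epsilon> * x j \<le> \<epsilon> * (c + M)" "\<epsilon> * (c - M) \<le> \<epsilon> * x j"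
      using M[OF that] \<open>0 \<le> \<epsilon>\<close> by (auto intro!: mult_left_mono)
    then show "- \<epsilon> * c - \<epsilon> * M \<le> - \<epsilon> * x j" "- \<epsilon> * x j \<le> - \<epsilon> * c + \<epsilon> * M"
      by (auto simp: algebra_simps)
  qed
  have "(\<Sum>j\<in>A. exp (- \<epsilon> * x j)) \<le> real (card A) * exp (- \<epsilon> * c + \<epsilon> * M)"
    using b by (intro sum_bounded_above) auto
  then have "log_sum_exp \<epsilon> A x \<le> ln (real (card A) * exp (- \<epsilon> * c + \<epsilon> * M))"
    unfolding log_sum_exp_def using S card by (subst ln_le_cancel_iff) auto
  moreover have "real (card A) * exp (- \<epsilon> * c - \<epsilon> * M) \<le> (\<Sum>j\<in>A. exp (- \<epsilon> * x j))"
    using b by (intro sum_bounded_below) auto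
  then have "ln (real (card A) * exp (- \<epsilon> * c - \<epsilon> * M)) \<le> log_sum_exp \<epsilon> A x"
    unfolding log_sum_exp_def using S card by (subst ln_le_cancel_iff) auto
  ultimately show ?thesis using card by (simp add: ln_mult abs_le_iff)
qed

text \<open>Serves the event that the variance of \<open>x\<close> is tiny: the bound is
  proportional to that variance, so the quotient of the two variances stays below
  \<open>\<epsilon>\<^sup>2 * real n\<close>.\<close>

lemma unif_cov_log_sum_exp_le:
  assumes "n > 0" "0 \<le> \<epsilon>" and A: "\<And>i. i < n \<Longrightarrow> A i \<subseteq> {..<n}" "\<And>i. i < n \<Longrightarrow> card (A i) = d" and "d > 0"
  shows "unif_cov n (\<lambda>i. log_sum_exp \<epsilon> (A i) x) (\<lambda>i. log_sum_exp \<epsilon> (A i) x) \<le> \<epsilon>\<^sup>2 * (real n * unif_cov n x x)"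
proof -
  define c where "c = unif_mean n x"
  define V where "V = (\<Sum>i<n. (x i - c)\<^sup>2)"
  have V: "real n * unif_cov n x x = V" "V \<ge> 0"
    using \<open>n > 0\<close> by (auto simp: unif_cov_def V_def c_def power2_eq_square intro!: sum_nonneg)
  \<comment> \<open>A single deviation is at most the root of the sum \<open>V\<close> of all
    squared deviations; this costs the factor \<open>n\<close>.\<close>
  have dev: "\<bar>x j - c\<bar> \<le> sqrt V" if "j < n" for j
  proof -
    have "(x j - c)\<^sup>2 \<le> V" unfolding V_def using that by (intro member_le_sum) auto
    then show ?thesis using real_le_rsqrt by (metis power2_abs)
  qed
  have "(log_sum_exp \<epsilon> (A i) x - (ln d - \<epsilon> * c))\<^sup>2 \<le> \<epsilon>\<^sup>2 * V" if "i < n" for i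
  proof -
    have "finite (A i)" "A i \<noteq> {}" using A[OF that] \<open>d > 0\<close> finite_subset by fastforce+
    then have "\<bar>log_sum_exp \<epsilon> (A i) x - (ln (card (A i)) - \<epsilon> * c)\<bar> \<le> \<epsilon> * sqrt V"
      using A[OF that] by (intro log_sum_exp_deviation \<open>0 \<le> \<epsilon>\<close> dev) auto
    then have "\<bar>log_sum_exp \<epsilon> (A i) x - (ln d - \<epsilon> * c)\<bar>\<^sup>2 \<le> (\<epsilon> * sqrt V)\<^sup>2"
      using A[OF that] by (intro power_mono) auto
    then show ?thesis using V by (simp add: power_mult_distrib)
  qed
  then have "(\<Sum>i<n. (log_sum_exp \<epsilon> (A i) x - (ln d - \<epsilon> * c))\<^sup>2) \<le> real n * (\<epsilon>\<^sup>2 * V)"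
    using sum_bounded_above[of "{..<n}" "\<lambda>i. (log_sum_exp \<epsilon> (A i) x - (ln d - \<epsilon> * c))\<^sup>2" "\<epsilon>\<^sup>2 * V"] by simp
  then have "(\<Sum>i<n. (log_sum_exp \<epsilon> (A i) x - (ln d - \<epsilon> * c))\<^sup>2) / real n \<le> \<epsilon>\<^sup>2 * V"
    using \<open>n > 0\<close> by (simp add: divide_le_eq mult.commute)
  with unif_cov_self_le[OF \<open>n > 0\<close>, of "\<lambda>i. log_sum_exp \<epsilon> (A i) x" "ln d - \<epsilon> * c"]
  show ?thesis using V by simp
qed

section \<open>The stationary distribution and the correlation\<close>

text \<open>Existence is detailed balance. Uniqueness, which the definite description requires, is
  the maximum principle for the density of \<open>p\<close> relative to \<open>exp (- W i)\<close>,
  together with connectedness.\<close>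

lemma stationary_dist_REM:
  assumes G: "simple_graph_on n E" "graph_connected n E" and "n > 0" "i < n"
  shows "stationary_dist n E (REM n E lam W) i = exp (- W i) / (\<Sum>j<n. exp (- W j))"
proof -
  let ?R = "REM n E lam W"
  define Z where "Z = (\<Sum>j<n. exp (- W j))"
  define p0 where "p0 i = (if i < n then exp (- W i) / Z else 0)" for i
  \<comment> \<open>Symmetric conductances: on every edge the rate is
    \<open>exp (W i) * c i j\<close>.\<close>
  define c where "c i j = exp (- (1 - lam) * (W i + W j))" for i j
  have Z: "Z > 0" unfolding Z_def using \<open>n > 0\<close> by (intro sum_pos) auto
  have sym: "E i j \<Longrightarrow> E j i" and bnd: "E i j \<Longrightarrow> i < n" "E i j \<Longrightarrow> j < n" for i j
    using G by (auto simp: simple_graph_on_def)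
  have R: "?R i j = exp (W i) * c i j" if "E i j" for i j
    using bnd[OF that] that by (simp add: REM_def c_def algebra_simps flip: exp_add)
  have c_sym: "c i j = c j i" for i j by (simp add: c_def add.commute)
  have nb: "{i. i < n \<and> E i j} = {i. i < n \<and> E j i}" for j using sym by auto
  have q: "exit_rate n E ?R j = (\<Sum>i\<in>{i. i < n \<and> E j i}. exp (W j) * c i j)" for j
    unfolding exit_rate_def by (intro sum.cong) (auto simp: R c_sym)
  have "is_stationary n E ?R p0"
    unfolding is_stationary_def
  proof (intro conjI allI impI)
    show "(\<Sum>i<n. p0 i) = 1"
      using Z by (simp add: p0_def Z_def flip: sum_divide_distrib)
    fix j assume j: "j < n"
    show "(\<Sum>i\<in>{i. i < n \<and> E i j}. p0 i * ?R i j) = p0 j * exit_rate n E ?R j"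
      unfolding nb q sum_distrib_left
      by (intro sum.cong) (auto simp: p0_def j R[OF sym] simp flip: mult.assoc exp_add)
  qed (use Z in \<open>auto simp: p0_def\<close>)
  moreover have "p = p0" if p: "is_stationary n E ?R p" for p
  proof -
    define u where "u i = p i * exp (W i)" for i
    have "Max (u ` {..<n}) \<in> u ` {..<n}" using \<open>n > 0\<close> by (intro Max_in) auto
    then obtain j0 where j0: "j0 < n" "u j0 = Max (u ` {..<n})" by auto
    then have max: "u i \<le> u j0" if "i < n" for i using that by simp
    \<comment> \<open>Stationarity makes \<open>u v\<close> a weighted average of \<open>u\<close>
      over the neighbours of \<open>v\<close> with positive weights, so a maximum at
      \<open>v\<close> spreads to all its neighbours.\<close>
    have step: "u w = u j0" if "E v w" "u v = u j0" for v w
    proof -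
      have "(\<Sum>i\<in>{i. i < n \<and> E i v}. p i * ?R i v) = p v * exit_rate n E ?R v"
        using p bnd(1)[OF \<open>E v w\<close>] by (auto simp: is_stationary_def)
      moreover have "(\<Sum>i\<in>{i. i < n \<and> E i v}. p i * ?R i v) = (\<Sum>i\<in>{i. i < n \<and> E v i}. u i * c i v)"
        unfolding nb by (intro sum.cong) (auto simp: R[OF sym] u_def)
      moreover have "p v * exit_rate n E ?R v = (\<Sum>i\<in>{i. i < n \<and> E v i}. u v * c i v)"
        by (simp add: q u_def sum_distrib_left mult.assoc)
      ultimately have "(\<Sum>i\<in>{i. i < n \<and> E v i}. (u j0 - u i) * c i v) = 0"
        using that by (simp add: left_diff_distrib sum_subtractf)
      then have "\<forall>i\<in>{i. i < n \<and> E v i}. (u j0 - u i) * c i v = 0"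
        by (subst (asm) sum_nonneg_eq_0_iff) (auto intro!: mult_nonneg_nonneg max simp: c_def)
      then show ?thesis using that bnd(2)[OF \<open>E v w\<close>] by (auto simp: c_def)
    qed
    have const: "u i = u j0" if "i < n" for i
    proof -
      have "(j0, i) \<in> {(a, b). E a b}\<^sup>*" using G j0 that by (auto simp: graph_connected_def)
      then show ?thesis by (induction rule: rtrancl_induct) (auto intro: step)
    qed
    have pi: "p i = u j0 * exp (- W i)" if "i < n" for i
      using const[OF that] by (simp add: u_def exp_minus field_simps)
    have "(\<Sum>i<n. p i) = u j0 * Z"
      unfolding Z_def sum_distrib_left by (intro sum.cong) (auto simp: pi)
    with p have "u j0 * Z = 1" by (simp add: is_stationary_def)
    with Z have "u j0 = 1 / Z" by (simp add: field_simps)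
    then show ?thesis
      using p pi by (auto simp: p0_def fun_eq_iff is_stationary_def)
  qed
  ultimately have "stationary_dist n E ?R = p0"
    unfolding stationary_dist_def by (rule the_equality)
  then show ?thesis using \<open>i < n\<close> by (simp add: p0_def Z_def)
qed

text \<open>The normalization \<open>?Z\<close> only adds a constant to the negative logarithm of
  the stationary distribution, and covariances ignore constants.\<close>

lemma rho_REM:
  assumes G: "simple_graph_on n E" "graph_connected n E" and "n > 0"
    and d: "\<And>i. i < n \<Longrightarrow> card {j. j < n \<and> E i j} > 0"
  shows "rho n E (REM n E lam W) =
    unif_corr n W (\<lambda>i. lam * W i + log_sum_exp (1 - lam) {j. j < n \<and> E i j} W)"
proof -
  let ?Z = "\<Sum>j<n. exp (- W j)"
  have Z: "?Z > 0" using \<open>n > 0\<close> by (intro sum_pos) auto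
  \<comment> \<open>The factor 1 brings the expression into the form \<open>c * y i + z i\<close> of
    the affine rules for \<open>unif_cov\<close>.\<close>
  have p: "- ln (stationary_dist n E (REM n E lam W) i) = 1 * W i + ln ?Z" if "i < n" for i
    using Z by (simp add: stationary_dist_REM[OF G \<open>n > 0\<close> that] ln_div)
  have q: "ln (exit_rate n E (REM n E lam W) i) = lam * W i + log_sum_exp (1 - lam) {j. j < n \<and> E i j} W"
    if "i < n" for i
  proof -
    have "exit_rate n E (REM n E lam W) i = exp (lam * W i) * (\<Sum>j\<in>{j. j < n \<and> E i j}. exp (- (1 - lam) * W j))"
      unfolding exit_rate_def sum_distrib_left
      using that by (intro sum.cong) (auto simp: REM_def algebra_simps simp flip: exp_add)
    moreover have "(\<Sum>j\<in>{j. j < n \<and> E i j}. exp (- (1 - lam) * W j)) > 0"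
      using d[OF that] by (intro sum_pos) (auto simp: card_gt_0_iff)
    ultimately show ?thesis by (simp add: ln_mult log_sum_exp_def)
  qed
  let ?x = "\<lambda>i. - ln (stationary_dist n E (REM n E lam W) i)"
  let ?y = "\<lambda>i. ln (exit_rate n E (REM n E lam W) i)"
  let ?y' = "\<lambda>i. lam * W i + log_sum_exp (1 - lam) {j. j < n \<and> E i j} W"
  let ?x' = "\<lambda>i. 1 * W i + ln ?Z"
  have shift: "unif_cov n ?x' z = unif_cov n W z" for z
    unfolding unif_cov_affine_left unif_cov_commute[of n "\<lambda>_. ln ?Z"] unif_cov_const_right by simp
  have "unif_cov n ?x ?y = unif_cov n ?x' ?y'"
    by (rule unif_cov_cong) (simp_all only: p q)
  then have "unif_cov n ?x ?y = unif_cov n W ?y'" by (simp only: shift)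
  moreover have "unif_cov n ?x ?x = unif_cov n ?x' ?x'"
    by (rule unif_cov_cong) (simp_all only: p)
  then have "unif_cov n ?x ?x = unif_cov n W W"
    by (simp only: shift unif_cov_commute[of n W ?x'])
  moreover have "unif_cov n ?y ?y = unif_cov n ?y' ?y'"
    by (rule unif_cov_cong) (simp_all add: q)
  ultimately show ?thesis by (simp add: rho_def unif_corr_def)
qed

section \<open>Lower tail of the empirical variance\<close>

lemma nn_integral_normal_density: "\<sigma> > 0 \<Longrightarrow> (\<integral>\<^sup>+x. ennreal (normal_density \<mu> \<sigma> x) \<partial>lborel) = 1"
  by (subst nn_integral_eq_integral) auto

text \<open>Completing the square: exponential tilting moves the mean of the density to
  \<open>s * \<sigma>\<^sup>2\<close>.\<close>

lemma nn_integral_exp_centered_normal: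
  assumes \<sigma>: "\<sigma> > 0"
  shows "(\<integral>\<^sup>+x. ennreal (exp (s * x)) \<partial>centered_normal \<sigma>) = ennreal (exp (s\<^sup>2 * \<sigma>\<^sup>2 / 2))"
proof -
  have "normal_density 0 \<sigma> x * exp (s * x) = exp (s\<^sup>2 * \<sigma>\<^sup>2 / 2) * normal_density (s * \<sigma>\<^sup>2) \<sigma> x" for x
  proof -
    have "- (x\<^sup>2) / (2 * \<sigma>\<^sup>2) + s * x = s\<^sup>2 * \<sigma>\<^sup>2 / 2 + - ((x - s * \<sigma>\<^sup>2)\<^sup>2) / (2 * \<sigma>\<^sup>2)"
      using \<sigma> by (simp add: field_simps power2_eq_square)
    then have "exp (- (x\<^sup>2) / (2 * \<sigma>\<^sup>2)) * exp (s * x)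
        = exp (s\<^sup>2 * \<sigma>\<^sup>2 / 2) * exp (- ((x - s * \<sigma>\<^sup>2)\<^sup>2) / (2 * \<sigma>\<^sup>2))"
      by (simp only: flip: exp_add)
    then show ?thesis by (simp add: normal_density_def)
  qed
  then show ?thesis
    by (simp add: nn_integral_density ennreal_mult'[symmetric] del: ennreal_mult'')
      (simp add: ennreal_mult' nn_integral_cmult nn_integral_normal_density \<sigma>)
qed

text \<open>The exponent \<open>3 / 2\<close> is chosen so that the product with the density is
  again Gaussian with a simple scale: half the density of standard deviation
  \<open>\<sigma> / 2\<close>.\<close>

lemma nn_integral_exp_neg_sq_centered_normal:
  assumes \<sigma>: "\<sigma> > 0"
  shows "(\<integral>\<^sup>+x. ennreal (exp (- (3 / 2) * (x / \<sigma>)\<^sup>2)) \<partial>centered_normal \<sigma>) = ennreal (1 / 2)"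
proof -
  have "normal_density 0 \<sigma> x * exp (- (3 / 2) * (x / \<sigma>)\<^sup>2) = 1 / 2 * normal_density 0 (\<sigma> / 2) x" for x
  proof -
    have "- (x\<^sup>2) / (2 * \<sigma>\<^sup>2) + - (3 / 2) * (x / \<sigma>)\<^sup>2 = - (x\<^sup>2) / (2 * (\<sigma> / 2)\<^sup>2)"
      using \<sigma> by (simp add: field_simps power2_eq_square)
    then have "exp (- (x\<^sup>2) / (2 * \<sigma>\<^sup>2)) * exp (- (3 / 2) * (x / \<sigma>)\<^sup>2) = exp (- (x\<^sup>2) / (2 * (\<sigma> / 2)\<^sup>2))"
      by (simp only: flip: exp_add)
    moreover have "sqrt (2 * pi * (\<sigma> / 2)\<^sup>2) = sqrt (2 * pi * \<sigma>\<^sup>2) / 2"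
      using \<sigma> by (simp add: real_sqrt_mult)
    ultimately show ?thesis by (simp add: normal_density_def)
  qed
  then have "ennreal (normal_density 0 \<sigma> x) * ennreal (exp (- (3 / 2) * (x / \<sigma>)\<^sup>2))
      = ennreal (1 / 2) * ennreal (normal_density 0 (\<sigma> / 2) x)" for x
    by (subst (1 2) ennreal_mult[symmetric]) simp_all
  then have "(\<integral>\<^sup>+x. ennreal (exp (- (3 / 2) * (x / \<sigma>)\<^sup>2)) \<partial>centered_normal \<sigma>)
      = (\<integral>\<^sup>+x. ennreal (1 / 2) * ennreal (normal_density 0 (\<sigma> / 2) x) \<partial>lborel)"
    by (subst nn_integral_density) (simp_all only:, measurable)
  also have "\<dots> = ennreal (1 / 2) * 1"
    using nn_integral_normal_density[of "\<sigma> / 2" 0] \<sigma> by (subst nn_integral_cmult) auto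
  finally show ?thesis by simp
qed

lemma nn_integral_gauss_vec_prod:
  assumes \<sigma>: "\<sigma> > 0" and [measurable]: "f \<in> borel_measurable borel" and nonneg: "\<And>x. 0 \<le> f x"
  shows "(\<integral>\<^sup>+W. ennreal (\<Prod>i<n. f (W i)) \<partial>gauss_vec n \<sigma>) = (\<integral>\<^sup>+x. ennreal (f x) \<partial>centered_normal \<sigma>) ^ n"
proof -
  interpret product_sigma_finite "\<lambda>_::nat. centered_normal \<sigma>"
    by (rule product_sigma_finite.intro) (intro prob_space_imp_sigma_finite prob_space_normal_density \<sigma>)
  show ?thesis
    unfolding gauss_vec_def
    using product_nn_integral_prod[of "{..<n}" "\<lambda>_ x. ennreal (f x)"] nonneg
    by (simp add: prod_ennreal)
qed

text \<open>
  A variance below \<open>\<sigma>\<^sup>2 / 3\<close> forces the mean square below \<open>2 \<sigma>\<^sup>2 / 5\<close> or the squared mean above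
  \<open>\<sigma>\<^sup>2 / 15\<close>. The three summands are the exponential Markov bounds for the first event and for the
  two signs of the mean in the second one.
\<close>

definition small_variance_bound :: "nat \<Rightarrow> real \<Rightarrow> (nat \<Rightarrow> real) \<Rightarrow> real" where
  "small_variance_bound n \<sigma> W =
     exp (3 / 5 * n) * (\<Prod>i<n. exp (- (3 / 2) * (W i / \<sigma>)\<^sup>2))
   + (exp (- real n / 15) * (\<Prod>i<n. exp (sqrt (1 / 15) / \<sigma> * W i))
   + exp (- real n / 15) * (\<Prod>i<n. exp (- (sqrt (1 / 15) / \<sigma>) * W i)))"

lemma small_variance_bound_nonneg: "0 \<le> small_variance_bound n \<sigma> W"
  unfolding small_variance_bound_def by (intro add_nonneg_nonneg mult_nonneg_nonneg prod_nonneg) auto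

lemma unif_cov_self_eq:
  assumes "n > 0"
  shows "unif_cov n x x = (\<Sum>i<n. (x i)\<^sup>2) / n - (unif_mean n x)\<^sup>2"
proof -
  let ?\<mu> = "unif_mean n x"
  have s: "(\<Sum>i<n. x i) = real n * ?\<mu>" using assms by (simp add: unif_mean_def)
  have "(\<Sum>i<n. (x i - ?\<mu>) * (x i - ?\<mu>)) = (\<Sum>i<n. (x i)\<^sup>2 + ?\<mu>\<^sup>2 - 2 * ?\<mu> * x i)"
    by (intro sum.cong) (auto simp: power2_eq_square algebra_simps)
  also have "\<dots> = (\<Sum>i<n. (x i)\<^sup>2) - real n * ?\<mu>\<^sup>2"
    by (simp add: sum.distrib sum_subtractf s flip: sum_distrib_left) (simp add: power2_eq_square)
  finally show ?thesis using assms by (simp add: unif_cov_def diff_divide_distrib)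
qed

lemma one_le_small_variance_bound:
  assumes \<sigma>: "\<sigma> > 0" and n: "n > 0" and small: "unif_cov n W W < \<sigma>\<^sup>2 / 3"
  shows "1 \<le> small_variance_bound n \<sigma> W"
proof -
  let ?s = "sqrt (1 / 15) / \<sigma>"
  let ?\<mu> = "unif_mean n W"
  have e1: "(\<Prod>i<n. exp (- (3 / 2) * (W i / \<sigma>)\<^sup>2)) = exp (- (3 / 2) * ((\<Sum>i<n. (W i)\<^sup>2) / \<sigma>\<^sup>2))"
    by (simp add: exp_sum[symmetric] power_divide sum_divide_distrib sum_distrib_left sum_negf)
  have e2: "(\<Prod>i<n. exp (c * W i)) = exp (c * (\<Sum>i<n. W i))" for c
    by (simp add: exp_sum[symmetric] sum_distrib_left)
  have s: "(\<Sum>i<n. W i) = real n * ?\<mu>" using n by (simp add: unif_mean_def)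
  have pos: "0 \<le> exp a * exp b" for a b :: real by simp
  \<comment> \<open>If both failed, the variance would be at least
    \<open>2 / 5 - 1 / 15 = 1 / 3\<close> times \<open>\<sigma>\<^sup>2\<close>.\<close>
  consider "(\<Sum>i<n. (W i)\<^sup>2) < 2 / 5 * n * \<sigma>\<^sup>2" | "?\<mu>\<^sup>2 > \<sigma>\<^sup>2 / 15"
  proof (rule ccontr)
    assume a: "\<not> thesis"
    then have "2 / 5 * n * \<sigma>\<^sup>2 \<le> (\<Sum>i<n. (W i)\<^sup>2)" "?\<mu>\<^sup>2 \<le> \<sigma>\<^sup>2 / 15" using that by force+
    then have "2 / 5 * \<sigma>\<^sup>2 \<le> (\<Sum>i<n. (W i)\<^sup>2) / n" "?\<mu>\<^sup>2 \<le> \<sigma>\<^sup>2 / 15"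
      using n by (auto simp: field_simps)
    then show False using small unfolding unif_cov_self_eq[OF n] by simp
  qed
  then show ?thesis
  proof cases
    case 1
    then have "(\<Sum>i<n. (W i)\<^sup>2) / \<sigma>\<^sup>2 \<le> 2 / 5 * n" using \<sigma> by (simp add: divide_le_eq)
    \<comment> \<open>The rate \<open>3 / 5\<close> is the exponent \<open>3 / 2\<close> times the
      threshold \<open>2 / 5\<close>.\<close>
    then have "1 \<le> exp (3 / 5 * n) * exp (- (3 / 2) * ((\<Sum>i<n. (W i)\<^sup>2) / \<sigma>\<^sup>2))"
      by (simp flip: exp_add)
    then show ?thesis unfolding small_variance_bound_def e1 e2
      using pos by (smt (verit))
  next
    case 2
    have "sqrt (\<sigma>\<^sup>2 / 15) < sqrt (?\<mu>\<^sup>2)" using 2 by (rule real_sqrt_less_mono)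
    then have *: "sqrt (1 / 15) * \<sigma> < \<bar>?\<mu>\<bar>" using \<sigma> by (simp add: real_sqrt_divide)
    \<comment> \<open>The parameter \<open>?s\<close> is the optimal one in the Chernoff bound for a
      mean deviating by \<open>sqrt (1 / 15) * \<sigma>\<close>.\<close>
    have sq: "?s * (sqrt (1 / 15) * \<sigma>) = 1 / 15" using \<sigma> by simp
    have "?s * (sqrt (1 / 15) * \<sigma>) \<le> ?s * \<bar>?\<mu>\<bar>"
      using * \<sigma> by (intro mult_left_mono) auto
    then have "1 / 15 \<le> ?s * \<bar>?\<mu>\<bar>" by (simp only: sq)
    then have **: "real n * (1 / 15) \<le> real n * (?s * \<bar>?\<mu>\<bar>)" by (intro mult_left_mono) auto
    show ?thesis
    proof (cases "?\<mu> \<ge> 0")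
      case True
      then have "1 \<le> exp (- real n / 15) * exp (?s * (\<Sum>i<n. W i))"
        using ** by (simp add: s mult.left_commute flip: exp_add)
      then show ?thesis unfolding small_variance_bound_def e1 e2
        using pos by (smt (verit))
    next
      case False
      then have "1 \<le> exp (- real n / 15) * exp (- ?s * (\<Sum>i<n. W i))"
        using ** by (simp add: s mult.left_commute flip: exp_add)
      then show ?thesis unfolding small_variance_bound_def e1 e2
        using pos by (smt (verit))
    qed
  qed
qed

lemma borel_measurable_gauss_vec_component [measurable]:
  "i < n \<Longrightarrow> (\<lambda>W. W i) \<in> borel_measurable (gauss_vec n \<sigma>)"
  using measurable_component_singleton[of i "{..<n}" "\<lambda>_. centered_normal \<sigma>"] by (simp add: gauss_vec_def)

lemma borel_measurable_small_variance_bound [measurable]: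
  "small_variance_bound n \<sigma> \<in> borel_measurable (gauss_vec n \<sigma>)"
  unfolding small_variance_bound_def[abs_def] by measurable

text \<open>Each of the two terms for the mean has exponent \<open>- n / 15 + n / 30\<close>. The
  term for the mean square is \<open>(exp (3 / 5) / 2) ^ n\<close>, which
  \<open>exp (2 / 3) \<le> 2\<close> bounds by \<open>exp (- n / 15)\<close>.\<close>

lemma nn_integral_small_variance_bound_le:
  assumes \<sigma>: "\<sigma> > 0"
  shows "(\<integral>\<^sup>+W. ennreal (small_variance_bound n \<sigma> W) \<partial>gauss_vec n \<sigma>) \<le> ennreal (3 * exp (- real n / 30))"
proof -
  have sq: "(sqrt (1 / 15) / \<sigma>)\<^sup>2 * \<sigma>\<^sup>2 / 2 = 1 / 30"
    using \<sigma> by (simp add: power_divide)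
  have two: "exp (2 / 3) \<le> (2::real)"
    using ln2_ge_two_thirds by (subst ln_ge_iff[symmetric]) auto
  have "(\<integral>\<^sup>+W. ennreal (small_variance_bound n \<sigma> W) \<partial>gauss_vec n \<sigma>)
      = ennreal (exp (3 / 5 * n)) * (\<integral>\<^sup>+W. ennreal (\<Prod>i<n. exp (- (3 / 2) * (W i / \<sigma>)\<^sup>2)) \<partial>gauss_vec n \<sigma>)
      + (ennreal (exp (- real n / 15)) * (\<integral>\<^sup>+W. ennreal (\<Prod>i<n. exp (sqrt (1 / 15) / \<sigma> * W i)) \<partial>gauss_vec n \<sigma>)
      + ennreal (exp (- real n / 15)) * (\<integral>\<^sup>+W. ennreal (\<Prod>i<n. exp (- (sqrt (1 / 15) / \<sigma>) * W i)) \<partial>gauss_vec n \<sigma>))"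
    unfolding small_variance_bound_def
    by (simp add: nn_integral_add nn_integral_cmult ennreal_mult prod_nonneg flip: nn_integral_cmult)
  also have "\<dots> = ennreal (exp (3 / 5 * n)) * ennreal (1 / 2) ^ n
      + (ennreal (exp (- real n / 15)) * ennreal (exp (1 / 30)) ^ n + ennreal (exp (- real n / 15)) * ennreal (exp (1 / 30)) ^ n)"
    by (subst (1 2 3) nn_integral_gauss_vec_prod)
      (simp_all only: nn_integral_exp_centered_normal[OF \<sigma>] nn_integral_exp_neg_sq_centered_normal[OF \<sigma>]
        power2_minus sq \<sigma> exp_ge_zero, measurable)
  also have "\<dots> = ennreal (exp (3 / 5 * n) * (1 / 2) ^ n + 2 * (exp (- real n / 15) * exp (1 / 30) ^ n))"
  proof -
    have "ennreal a * ennreal b + (ennreal c * ennreal d + ennreal c * ennreal d) = ennreal (a * b + 2 * (c * d))"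
      if "0 \<le> a" "0 \<le> b" "0 \<le> c" "0 \<le> d" for a b c d
      using that by (simp flip: ennreal_mult ennreal_plus)
    then show ?thesis by (subst (1 2 3) ennreal_power) simp_all
  qed
  also have "\<dots> \<le> ennreal (3 * exp (- real n / 30))"
  proof (intro ennreal_leI)
    have "exp (3 / 5 * n) * (1 / 2) ^ n = (exp (3 / 5) / 2) ^ n"
      by (simp add: power_divide mult.commute flip: exp_of_nat_mult)
    also have "\<dots> \<le> (exp (3 / 5) / exp (2 / 3)) ^ n"
      using two by (intro power_mono divide_left_mono) auto
    also have "\<dots> = exp (- real n / 15)"
      by (simp flip: exp_diff exp_of_nat_mult)
    also have "\<dots> \<le> exp (- real n / 30)" by simp
    finally have 1: "exp (3 / 5 * n) * (1 / 2) ^ n \<le> exp (- real n / 30)" .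
    have "exp (- real n / 15) * exp (1 / 30) ^ n = exp (- real n / 30)"
      by (simp flip: exp_of_nat_mult exp_add)
    with 1 show "exp (3 / 5 * n) * (1 / 2) ^ n + 2 * (exp (- real n / 15) * exp (1 / 30) ^ n) \<le> 3 * exp (- real n / 30)"
      by linarith
  qed
  finally show ?thesis .
qed

text \<open>Zero variance would force \<open>W 0 = W 1\<close>, which for fixed other coordinates
  confines \<open>W 0\<close> to a single point. The bound on one minus the correlation divides by
  this variance.\<close>

lemma AE_gauss_vec_unif_cov_pos:
  assumes \<sigma>: "\<sigma> > 0" and n: "n \<ge> 2"
  shows "AE W in gauss_vec n \<sigma>. unif_cov n W W > 0"
proof -
  let ?N = "centered_normal \<sigma>"
  interpret product_sigma_finite "\<lambda>_::nat. ?N"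
    by (rule product_sigma_finite.intro) (intro prob_space_imp_sigma_finite prob_space_normal_density \<sigma>)
  have ins: "{..<n} = insert 0 {1..<n}" using n by auto
  define f :: "(nat \<Rightarrow> real) \<Rightarrow> ennreal" where "f W = (if W 0 = W 1 then 1 else 0)" for W
  have fm: "f \<in> borel_measurable (gauss_vec n \<sigma>)"
  proof -
    have [measurable]: "(\<lambda>W. W 0) \<in> borel_measurable (gauss_vec n \<sigma>)"
      "(\<lambda>W. W 1) \<in> borel_measurable (gauss_vec n \<sigma>)"
      using n by (auto intro: borel_measurable_gauss_vec_component)
    show ?thesis unfolding f_def[abs_def] by measurable
  qed
  have inner: "(\<integral>\<^sup>+y. f (x(0 := y)) \<partial>?N) = 0" for x
  proof -
    have "(\<integral>\<^sup>+y. f (x(0 := y)) \<partial>?N) = (\<integral>\<^sup>+y. ennreal (normal_density 0 \<sigma> y) * f (x(0 := y)) \<partial>lborel)"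
      by (rule nn_integral_density) (auto simp: f_def)
    also have "\<dots> = (\<integral>\<^sup>+y. 0 \<partial>(lborel :: real measure))"
      by (intro nn_integral_cong_AE eventually_mono[OF AE_lborel_singleton[of "x 1"]]) (auto simp: f_def)
    finally show ?thesis by simp
  qed
  have "(\<integral>\<^sup>+W. f W \<partial>gauss_vec n \<sigma>) = (\<integral>\<^sup>+x. \<integral>\<^sup>+y. f (x(0 := y)) \<partial>?N \<partial>(\<Pi>\<^sub>M i\<in>{1..<n}. ?N))"
    using fm unfolding gauss_vec_def ins by (intro product_nn_integral_insert) auto
  then have "(\<integral>\<^sup>+W. f W \<partial>gauss_vec n \<sigma>) = 0" by (simp add: inner)
  then have "AE W in gauss_vec n \<sigma>. f W = 0"
    using fm by (simp add: nn_integral_0_iff_AE)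
  then show ?thesis
  proof (rule eventually_mono)
    fix W assume "f W = 0"
    then have "W 0 \<noteq> W 1" by (auto simp: f_def split: if_splits)
    then have "W 0 - unif_mean n W \<noteq> 0 \<or> W 1 - unif_mean n W \<noteq> 0" by auto
    then have "\<exists>i<n. W i - unif_mean n W \<noteq> 0"
      using n by (metis One_nat_def Suc_1 Suc_le_lessD less_le_trans zero_less_Suc pos2)
    then have "0 < (\<Sum>i<n. (W i - unif_mean n W) * (W i - unif_mean n W))"
      by (auto intro!: sum_pos2 simp: zero_less_mult_iff linorder_neq_iff)
    then show "unif_cov n W W > 0" using n by (simp add: unif_cov_def)
  qed
qed

section \<open>The expected correlation\<close>

lemma connected_regular_degree_pos:
  assumes G: "simple_graph_on n E" "graph_connected n E" and n: "n \<ge> 2"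
    and d: "\<And>i. i < n \<Longrightarrow> card {j. j < n \<and> E i j} = d"
  shows "d > 0"
proof -
  have "(0, 1) \<in> {(a, b). E a b}\<^sup>*" using G n by (auto simp: graph_connected_def)
  then obtain j where "E 0 j" by (auto elim: converse_rtranclE)
  then have "j \<in> {j. j < n \<and> E 0 j}" using G by (auto simp: simple_graph_on_def)
  then have "card {j. j < n \<and> E 0 j} > 0" by (auto simp: card_gt_0_iff)
  then show ?thesis using d[of 0] n by simp
qed

lemma expectation_rho_REM_ge:
  assumes G: "simple_graph_on n E" "graph_connected n E"
    and d: "\<And>i. i < n \<Longrightarrow> card {j. j < n \<and> E i j} = d"
    and n: "n \<ge> 2" and \<sigma>: "\<sigma> > 0" and lam: "0 \<le> lam" "lam \<le> 1"
  shows "1 - 16 * (1 + real n * exp (- real n / 30)) * (1 - lam)\<^sup>2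
    \<le> (\<integral>W. rho n E (REM n E lam W) \<partial>gauss_vec n \<sigma>)"
proof -
  define \<epsilon> where "\<epsilon> = 1 - lam"
  define A where "A i = {j. j < n \<and> E i j}" for i
  define L where "L W i = log_sum_exp \<epsilon> (A i) W" for W i
  define r where "r W = unif_corr n W (\<lambda>i. lam * W i + L W i)" for W
  let ?P = "gauss_vec n \<sigma>"
  interpret P: prob_space ?P
    unfolding gauss_vec_def by (intro prob_space_PiM prob_space_normal_density \<sigma>)
  have d0: "d > 0" by (rule connected_regular_degree_pos[OF G n d])
  have A: "A i \<subseteq> {..<n}" "finite (A i)" for i by (auto simp: A_def)
  have cA: "card (A i) = d" if "i < n" for i using d[OF that] by (simp add: A_def)
  have \<epsilon>: "0 \<le> \<epsilon>" using lam by (simp add: \<epsilon>_def)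
  have rho: "rho n E (REM n E lam W) = r W" for W
    unfolding r_def L_def \<epsilon>_def A_def using n d d0 by (intro rho_REM G) auto
  have [measurable]: "(\<lambda>W. L W i) \<in> borel_measurable ?P" for i
    unfolding L_def gauss_vec_def by (intro borel_measurable_log_sum_exp A)
  have rm[measurable]: "r \<in> borel_measurable ?P"
    unfolding r_def[abs_def] unif_corr_def unif_cov_def unif_mean_def by measurable
  have r1: "\<bar>r W\<bar> \<le> 1" for W unfolding r_def by (rule abs_unif_corr_le_1)
  have ri: "integrable ?P r"
    by (rule P.integrable_const_bound[where B = 1]) (use r1 in auto)
  have split: "(\<integral>W. 1 - r W \<partial>?P) = 1 - (\<integral>W. r W \<partial>?P)"
    using ri by (simp add: P.prob_space)
  have "(\<integral>W. 1 - r W \<partial>?P) \<le> 16 * (1 + real n * exp (- real n / 30)) * \<epsilon>\<^sup>2"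
  \<comment> \<open>At \<open>1 / 8\<close> the bound \<open>16 * \<epsilon>\<^sup>2\<close> reaches
    2, the largest possible value of \<open>1 - r W\<close>.\<close>
  proof (cases "\<epsilon>\<^sup>2 \<ge> 1 / 8")
    case True
    have "(\<integral>W. 1 - r W \<partial>?P) \<le> (\<integral>W. 2 \<partial>?P)"
    proof (rule integral_mono)
      show "1 - r W \<le> 2" for W using r1[of W] by linarith
    qed (use ri in auto)
    also have "\<dots> = 2" by (simp add: P.prob_space)
    also have "\<dots> \<le> 16 * (1 + 0) * \<epsilon>\<^sup>2" using True by simp
    also have "\<dots> \<le> 16 * (1 + real n * exp (- real n / 30)) * \<epsilon>\<^sup>2"
      by (intro mult_right_mono mult_left_mono add_left_mono) auto
    finally show ?thesis .
  next
    case False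
    \<comment> \<open>From \<open>1 / 8 < (3 / 8)\<^sup>2\<close> follows
      \<open>lam \<ge> 5 / 8\<close>, and \<open>25 / 64 \<ge> 3 / 8\<close>. The value
      \<open>3 / 8\<close> gives \<open>2 / lam\<^sup>2 \<le> 16 / 3\<close>, which the variance
      threshold \<open>\<sigma>\<^sup>2 / 3\<close> turns into the constant 16.\<close>
    have lam2: "lam\<^sup>2 \<ge> 3 / 8"
    proof -
      have "\<epsilon>\<^sup>2 \<le> (3 / 8)\<^sup>2" using False by (simp add: power2_eq_square)
      then have "\<epsilon> \<le> 3 / 8" by (rule power2_le_imp_le) simp
      then have "(5 / 8)\<^sup>2 \<le> lam\<^sup>2" by (intro power_mono) (auto simp: \<epsilon>_def)
      then show ?thesis by (simp add: power2_eq_square)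
    qed
    then have lam0: "lam > 0" using lam by (cases "lam = 0") auto
    obtain m where m: "(\<integral>\<^sup>+W. ennreal ((L W i - m)\<^sup>2) \<partial>?P) \<le> ennreal (\<epsilon>\<^sup>2 * \<sigma>\<^sup>2)" if "i < n" for i
      using log_sum_exp_concentration[OF \<sigma> d0, of \<epsilon>, where ?'a = nat] A cA
      unfolding L_def gauss_vec_def by metis
    define S where "S W = (\<Sum>i<n. (L W i - m)\<^sup>2)" for W
    define B where "B W = small_variance_bound n \<sigma> W" for W
    have [measurable]: "S \<in> borel_measurable ?P" "B \<in> borel_measurable ?P"
      unfolding S_def[abs_def] B_def[abs_def] by measurable
    have S0: "0 \<le> S W" for W by (simp add: S_def sum_nonneg)
    have B0: "0 \<le> B W" for W by (simp add: B_def small_variance_bound_nonneg)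
    \<comment> \<open>The first term handles variance at least \<open>\<sigma>\<^sup>2 / 3\<close>.
      In the second, \<open>B W\<close> dominates the indicator of the complementary event.\<close>
    let ?U = "\<lambda>W. 16 / (real n * \<sigma>\<^sup>2) * S W + 16 / 3 * \<epsilon>\<^sup>2 * real n * B W"
    have bound: "1 - r W \<le> ?U W" if pos: "unif_cov n W W > 0" for W
    proof -
      let ?V = "unif_cov n W W" and ?VL = "unif_cov n (L W) (L W)"
      have VL: "0 \<le> ?VL" by (rule unif_cov_self_nonneg)
      have "1 - r W \<le> 2 * ?VL / (lam\<^sup>2 * ?V)"
        unfolding r_def by (rule one_minus_unif_corr_le[OF pos lam0])
      also have "\<dots> \<le> 2 * ?VL / (3 / 8 * ?V)"
        using lam2 pos VL by (intro divide_left_mono mult_right_mono mult_pos_pos) auto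
      also have "\<dots> = 16 / 3 * (?VL / ?V)" by simp
      also have "\<dots> \<le> ?U W"
      proof (cases "?V \<ge> \<sigma>\<^sup>2 / 3")
        case True
        have "?VL \<le> S W / real n"
          unfolding S_def using n by (intro unif_cov_self_le) auto
        then have "?VL / ?V \<le> (S W / real n) / (\<sigma>\<^sup>2 / 3)"
          using True \<sigma> VL S0 by (intro frac_le) auto
        then have "16 / 3 * (?VL / ?V) \<le> 16 / 3 * ((S W / real n) / (\<sigma>\<^sup>2 / 3))"
          by (intro mult_left_mono) auto
        also have "\<dots> = 16 / (real n * \<sigma>\<^sup>2) * S W" by simp
        also have "\<dots> \<le> ?U W" using B0[of W] by simp
        finally show ?thesis .
      next
        case False
        have "?VL \<le> \<epsilon>\<^sup>2 * (real n * ?V)"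
          unfolding L_def using n \<epsilon> A cA d0 by (intro unif_cov_log_sum_exp_le) auto
        then have "?VL / ?V \<le> \<epsilon>\<^sup>2 * real n * 1"
          using pos by (simp add: divide_le_eq mult.assoc)
        also have "\<dots> \<le> \<epsilon>\<^sup>2 * real n * B W"
          unfolding B_def using n False by (intro mult_left_mono one_le_small_variance_bound \<sigma>) auto
        finally have "16 / 3 * (?VL / ?V) \<le> 16 / 3 * (\<epsilon>\<^sup>2 * real n * B W)"
          by (intro mult_left_mono) auto
        moreover have "0 \<le> 16 / (real n * \<sigma>\<^sup>2) * S W" using S0[of W] by simp
        ultimately show ?thesis by simp
      qed
      finally show ?thesis .
    qed
    have comb: "ennreal (a * b + c * d) = ennreal a * ennreal b + ennreal c * ennreal d"
      if "0 \<le> a" "0 \<le> b" "0 \<le> c" "0 \<le> d" for a b c d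
      using that by (simp flip: ennreal_mult ennreal_plus)
    have "ennreal (\<integral>W. 1 - r W \<partial>?P) = (\<integral>\<^sup>+W. ennreal (1 - r W) \<partial>?P)"
    proof (rule nn_integral_eq_integral[symmetric])
      show "AE W in ?P. 0 \<le> 1 - r W" using r1 by (intro always_eventually allI) (smt (verit))
    qed (use ri in simp)
    also have "\<dots> \<le> (\<integral>\<^sup>+W. ennreal (?U W) \<partial>?P)"
      by (intro nn_integral_mono_AE eventually_mono[OF AE_gauss_vec_unif_cov_pos[OF \<sigma> n]] ennreal_leI bound)
    also have "\<dots> = ennreal (16 / (real n * \<sigma>\<^sup>2)) * (\<Sum>i<n. \<integral>\<^sup>+W. ennreal ((L W i - m)\<^sup>2) \<partial>?P)
        + ennreal (16 / 3 * \<epsilon>\<^sup>2 * real n) * (\<integral>\<^sup>+W. ennreal (B W) \<partial>?P)"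
    proof -
      have "(\<integral>\<^sup>+W. ennreal (?U W) \<partial>?P)
          = (\<integral>\<^sup>+W. ennreal (16 / (real n * \<sigma>\<^sup>2)) * ennreal (S W)
              + ennreal (16 / 3 * \<epsilon>\<^sup>2 * real n) * ennreal (B W) \<partial>?P)"
        using S0 B0 by (intro nn_integral_cong comb) auto
      also have "\<dots> = ennreal (16 / (real n * \<sigma>\<^sup>2)) * (\<integral>\<^sup>+W. ennreal (S W) \<partial>?P)
          + ennreal (16 / 3 * \<epsilon>\<^sup>2 * real n) * (\<integral>\<^sup>+W. ennreal (B W) \<partial>?P)"
        by (simp add: nn_integral_add nn_integral_cmult)
      also have "(\<integral>\<^sup>+W. ennreal (S W) \<partial>?P) = (\<Sum>i<n. \<integral>\<^sup>+W. ennreal ((L W i - m)\<^sup>2) \<partial>?P)"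
        unfolding S_def by (subst nn_integral_sum[symmetric]) auto
      finally show ?thesis .
    qed
    also have "\<dots> \<le> ennreal (16 / (real n * \<sigma>\<^sup>2)) * (\<Sum>i<n. ennreal (\<epsilon>\<^sup>2 * \<sigma>\<^sup>2))
        + ennreal (16 / 3 * \<epsilon>\<^sup>2 * real n) * ennreal (3 * exp (- real n / 30))"
      unfolding B_def by (intro add_mono mult_left_mono sum_mono m nn_integral_small_variance_bound_le \<sigma>) auto
    also have "\<dots> = ennreal (16 / (real n * \<sigma>\<^sup>2)) * ennreal (real n * (\<epsilon>\<^sup>2 * \<sigma>\<^sup>2))
        + ennreal (16 / 3 * \<epsilon>\<^sup>2 * real n) * ennreal (3 * exp (- real n / 30))"
      by (simp only: sum_constant card_lessThan ennreal_mult'[OF of_nat_0_le_iff] ennreal_of_nat_eq_real_of_nat)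
    also have "\<dots> = ennreal (16 / (real n * \<sigma>\<^sup>2) * (real n * (\<epsilon>\<^sup>2 * \<sigma>\<^sup>2))
        + 16 / 3 * \<epsilon>\<^sup>2 * real n * (3 * exp (- real n / 30)))"
      by (rule comb[symmetric]) auto
    \<comment> \<open>The main term is exactly \<open>16 * \<epsilon>\<^sup>2\<close>; the
      small-variance event contributes the relative error
      \<open>real n * exp (- real n / 30)\<close>.\<close>
    also have "16 / (real n * \<sigma>\<^sup>2) * (real n * (\<epsilon>\<^sup>2 * \<sigma>\<^sup>2))
        + 16 / 3 * \<epsilon>\<^sup>2 * real n * (3 * exp (- real n / 30)) = 16 * (1 + real n * exp (- real n / 30)) * \<epsilon>\<^sup>2"
      using n \<sigma> by (simp add: algebra_simps)
    finally show ?thesis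
      by (subst (asm) ennreal_le_iff) (auto intro!: mult_nonneg_nonneg)
  qed
  then show ?thesis by (simp add: split rho \<epsilon>_def)
qed

theorem theorem2:
  "\<exists>C::real. \<forall>(n::nat) (E::nat \<Rightarrow> nat \<Rightarrow> bool) (\<sigma>::real) (lam::real).
     n \<ge> 6 \<and> simple_graph_on n E \<and> graph_connected n E \<and> graph_regular n E \<and>
     \<sigma> > 0 \<and> 0 \<le> lam \<and> lam \<le> 1 \<longrightarrow>
     (\<exists>e. \<bar>e\<bar> \<le> C / sqrt (real n) \<and>
        (\<integral>W. rho n E (REM n E lam W) \<partial>gauss_vec n \<sigma>) \<ge> 1 - 16 * (1 + e) * (1 - lam)^2)"
proof -
  \<comment> \<open>The witness for \<open>e\<close> will be
    \<open>real n * exp (- real n / 30)\<close>. Its product with \<open>sqrt (real n)\<close> tends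
    to zero, hence is bounded, and any bound serves as \<open>C\<close> because the sequence
    involves \<open>n\<close> alone.\<close>
  have "(\<lambda>n. real n * exp (- real n / 30) * sqrt (real n)) \<longlonglongrightarrow> 0" by real_asymp
  then have "Bseq (\<lambda>n. real n * exp (- real n / 30) * sqrt (real n))"
    by (intro convergent_imp_Bseq convergentI)
  then obtain C where C: "\<And>n. norm (real n * exp (- real n / 30) * sqrt (real n)) \<le> C"
    by (auto simp: Bseq_def)
  show ?thesis
  proof (rule exI[of _ C], intro allI impI)
    fix n E and \<sigma> lam :: real
    assume *: "n \<ge> 6 \<and> simple_graph_on n E \<and> graph_connected n E \<and> graph_regular n E \<and>
     \<sigma> > 0 \<and> 0 \<le> lam \<and> lam \<le> 1"
    then obtain d where "\<And>i. i < n \<Longrightarrow> card {j. j < n \<and> E i j} = d"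
      by (auto simp: graph_regular_def)
    with * have "1 - 16 * (1 + real n * exp (- real n / 30)) * (1 - lam)\<^sup>2
      \<le> (\<integral>W. rho n E (REM n E lam W) \<partial>gauss_vec n \<sigma>)"
      by (intro expectation_rho_REM_ge) auto
    moreover have "\<bar>real n * exp (- real n / 30)\<bar> \<le> C / sqrt (real n)"
      using C[of n] * by (simp add: pos_le_divide_eq abs_mult)
    ultimately show "\<exists>e. \<bar>e\<bar> \<le> C / sqrt (real n) \<and>
        (\<integral>W. rho n E (REM n E lam W) \<partial>gauss_vec n \<sigma>) \<ge> 1 - 16 * (1 + e) * (1 - lam)^2"
      by blast
  qed
qed

end
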